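(* Suppose Model 2 (described in the context) holds, the stochastic problem (P) in the context is feasible with optimal value $f^*$, and the Lagrange multiplier assumption holds for a nonnegative vector $\mu=(\mu_1,\dots,\mu_k)$. Fix $\epsilon>0$, define $V=1/\epsilon$, $\alpha=1/\epsilon^2$, and run the online algorithm described in the context with these parameters. Then for all integers $T\ge1/\epsilon^2$ and all $i\in\{1,\dots,k\}$ we have $$\frac{1}{T}\sum_{t=0}^{T-1}\mathbb{E}[f_t(X_t)]\le f^*+O(\epsilon),$$ $$\frac{1}{T}\sum_{t=0}^{T-1}\mathbb{E}[g_{t,i}(X_t)]\le O(\epsilon).$$
   Context: Setting. Fix positive integers $n,k$. $\mathcal{X}\subseteq\mathbb{R}^n$ is a convex compact set; $\|\cdot\|$ is the Euclidean norm; $D\ge 0$ is a constant with $\|x-y\|\le D$ for all $x,y\in\mathcal{X}$. Model 2. $\Omega$ is a finite dimensional vector space and $\{\omega_t\}_{t=0}^\infty$ is an i.i.d. sequence of random vectors in $\Omega$. For $t\in\{0,1,2,\dots\}$, $i\in\{1,\dots,k\}$, $f_t(x)=\hat f(x,\omega_t)$ and $g_{t,i}(x)=\hat g_i(x,\omega_t)$, where $\hat f,\hat g_i$ are continuous and convex in $x\in\mathcal{X}$. There is a constant $F\ge0$ with $|f_t(x)|\le F$, $|g_{t,i}(x)|\le F$ for all $t,i$ and $x\in\mathcal{X}$. For each of these functions a particular subgradient at each $x\in\mathcal{X}$ is fixed, denoted $f_t'(x)$, $g_{t,i}'(x)$ (so $f_t(y)\ge f_t(x)+f_t'(x)^T(y-x)$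 and $g_{t,i}(y)\ge g_{t,i}(x)+g_{t,i}'(x)^T(y-x)$ for all $y\in\mathcal{X}$), and $G>0$ is a constant with $\|f_t'(x)\|\le G$, $\|g_{t,i}'(x)\|\le G$ for all $t,i,x$. Decisions and the resulting function values are assumed to be random variables with well defined expectations. Valid decision sequence: a sequence of random vectors $\{X_t\}_{t=0}^\infty$ such that for every $t$, $X_t\in\mathcal{X}$ and $X_t$ is independent of $\omega_t$. Problem (P): over valid decision sequences, minimize $\limsup_{T\to\infty}\frac1T\sum_{t=0}^{T-1}\mathbb{E}[f_t(X_t)]$ subject to $\limsup_{T\to\infty}\frac1T\sum_{t=0}^{T-1}\mathbb{E}[g_{t,i}(X_t)]\le0$ for all $i\in\{1,\dots,k\}$ and $X_t\in\mathcal{X}$ for all $t$. It is feasible if some valid decision sequence satisfies the constraints; $f^*$ denotes the infimum objective value over all valid decision sequences satisfying the constraints. Lagrange multiplier assumption: there are nonnegative values $\mu_1,\dots,\mu_k$ such that for any valid decision sequence $\{X_t\}_{t=0}^\infty$ and any slot $t\in\{0,1,2,\dots\}$, $\mathbb{E}[f_t(X_t)]+\sum_{i=1}^k\mu_i\mathbb{E}[g_{t,i}(X_t)]\ge f^*$. Algorithm with parameters $V>0$, $\alpha>0$. Fix $x_0\in\mathcal{X}$ and set $X_0=x_0$. Virtual queues satisfy $Q_i(0)=Q_i(1)=0$ and, for $t\in\{1,2,3,\dots\}$, $$Q_i(t+1)=\max\left[Q_i(t)+g_{t-1,i}(X_{t-1})+g_{t-1,i}'(X_{t-1})^T(X_t-X_{t-1}),\,0\right].$$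 On each slot $t\in\{1,2,3,\dots\}$, $X_t$ is the (unique) minimizer over $x\in\mathcal{X}$ of $$\left[Vf_{t-1}'(X_{t-1})^T+\sum_{i=1}^kQ_i(t)g_{t-1,i}'(X_{t-1})^T\right]x+\alpha\|x-X_{t-1}\|^2.$$ $O(\epsilon)$ denotes a quantity at most $c\epsilon$ for a constant $c$ not depending on $\epsilon$ or $T$. *)

theory Defs
  imports "HOL-Probability.Probability"
begin

text \<open>
  The random functions of slot \<open>t\<close> are \<open>f\<^sub>t(x) = fhat x (\<omega> t s)\<close> and
  \<open>g\<^sub>t\<^sub>,\<^sub>i(x) = ghat i x (\<omega> t s)\<close> at the sample point \<open>s\<close>; the chosen subgradients are
  \<open>fsub t x (\<omega> t s)\<close> and \<open>gsub t i x (\<omega> t s)\<close>.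

  The last four assumptions make precise that decisions and function values are random variables.
  Measurability of \<open>fhat\<close> and \<open>ghat\<close> is only required for each fixed \<open>x\<close>, since they are continuous
  in \<open>x\<close>. A subgradient selection need not be continuous, so it has to be jointly measurable:
  for an arbitrary selection the iterates of the algorithm need not be Borel functions of
  \<open>\<omega> 0, \<dots>, \<omega> (t - 1)\<close>, and may then fail to be independent of \<open>\<omega> t\<close>.
\<close>

locale model2 = prob_space M
  for M :: "'s measure"
    and \<omega> :: "nat \<Rightarrow> 's \<Rightarrow> 'w::euclidean_space"
    and \<X> :: "(real ^ 'n) set"
    and k :: nat
    and fhat :: "real ^ 'n \<Rightarrow> 'w \<Rightarrow> real"
    and ghat :: "nat \<Rightarrow> real ^ 'n \<Rightarrow> 'w \<Rightarrow> real"
    and fsub :: "nat \<Rightarrow> real ^ 'n \<Rightarrow> 'w \<Rightarrow> real ^ 'n"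
    and gsub :: "nat \<Rightarrow> nat \<Rightarrow> real ^ 'n \<Rightarrow> 'w \<Rightarrow> real ^ 'n"
    and D F G :: real +
  assumes k_pos: "k \<ge> 1"
    and convex_X: "convex \<X>"
    and compact_X: "compact \<X>"
    and D_nonneg: "D \<ge> 0"
    and diameter_X: "\<And>x y. x \<in> \<X> \<Longrightarrow> y \<in> \<X> \<Longrightarrow> norm (x - y) \<le> D"
    and indep_omega: "indep_vars (\<lambda>_. borel) \<omega> UNIV"
    and ident_omega: "\<And>t. distr M borel (\<omega> t) = distr M borel (\<omega> 0)"
    and f_continuous: "\<And>w. continuous_on \<X> (\<lambda>x. fhat x w)"
    and f_convex: "\<And>w. convex_on \<X> (\<lambda>x. fhat x w)"
    and g_continuous: "\<And>i w. i \<in> {1..k} \<Longrightarrow> continuous_on \<X> (\<lambda>x. ghat i x w)"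
    and g_convex: "\<And>i w. i \<in> {1..k} \<Longrightarrow> convex_on \<X> (\<lambda>x. ghat i x w)"
    and F_nonneg: "F \<ge> 0"
    and f_bounded: "\<And>t s x. s \<in> space M \<Longrightarrow> x \<in> \<X> \<Longrightarrow> \<bar>fhat x (\<omega> t s)\<bar> \<le> F"
    and g_bounded: "\<And>t i s x. i \<in> {1..k} \<Longrightarrow> s \<in> space M \<Longrightarrow> x \<in> \<X> \<Longrightarrow>
                      \<bar>ghat i x (\<omega> t s)\<bar> \<le> F"
    and f_subgradient: "\<And>t s x y. s \<in> space M \<Longrightarrow> x \<in> \<X> \<Longrightarrow> y \<in> \<X> \<Longrightarrow>
                      fhat y (\<omega> t s) \<ge> fhat x (\<omega> t s) + fsub t x (\<omega> t s) \<bullet> (y - x)"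
    and g_subgradient: "\<And>t i s x y. i \<in> {1..k} \<Longrightarrow> s \<in> space M \<Longrightarrow> x \<in> \<X> \<Longrightarrow> y \<in> \<X> \<Longrightarrow>
                      ghat i y (\<omega> t s) \<ge> ghat i x (\<omega> t s) + gsub t i x (\<omega> t s) \<bullet> (y - x)"
    and G_pos: "G > 0"
    and fsub_bounded: "\<And>t s x. s \<in> space M \<Longrightarrow> x \<in> \<X> \<Longrightarrow> norm (fsub t x (\<omega> t s)) \<le> G"
    and gsub_bounded: "\<And>t i s x. i \<in> {1..k} \<Longrightarrow> s \<in> space M \<Longrightarrow> x \<in> \<X> \<Longrightarrow>
                      norm (gsub t i x (\<omega> t s)) \<le> G"
    and f_measurable: "\<And>x. x \<in> \<X> \<Longrightarrow> (\<lambda>w. fhat x w) \<in> borel_measurable borel"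
    and g_measurable: "\<And>i x. i \<in> {1..k} \<Longrightarrow> x \<in> \<X> \<Longrightarrow>
                      (\<lambda>w. ghat i x w) \<in> borel_measurable borel"
    and fsub_measurable: "\<And>t. (\<lambda>(x, w). fsub t x w)
                      \<in> borel_measurable (restrict_space borel \<X> \<Otimes>\<^sub>M borel)"
    and gsub_measurable: "\<And>t i. i \<in> {1..k} \<Longrightarrow> (\<lambda>(x, w). gsub t i x w)
                      \<in> borel_measurable (restrict_space borel \<X> \<Otimes>\<^sub>M borel)"

text \<open>
  The library's \<open>indep_var\<close> needs both random variables to have the same value type; this is the
  characterisation \<open>indep_var_eq\<close> for different value types.
\<close>

definition indep_rv ::
    "'s measure \<Rightarrow> ('s \<Rightarrow> 'a::topological_space) \<Rightarrow> ('s \<Rightarrow> 'b::topological_space) \<Rightarrow> bool" where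
  "indep_rv M X Y \<longleftrightarrow>
     X \<in> borel_measurable M \<and> Y \<in> borel_measurable M \<and>
     prob_space.indep_set M
       (sigma_sets (space M) {X -` A \<inter> space M | A. A \<in> sets borel})
       (sigma_sets (space M) {Y -` A \<inter> space M | A. A \<in> sets borel})"

definition valid_decision_seq ::
    "'s measure \<Rightarrow> (nat \<Rightarrow> 's \<Rightarrow> 'w::euclidean_space) \<Rightarrow> (real ^ 'n) set
      \<Rightarrow> (nat \<Rightarrow> 's \<Rightarrow> real ^ 'n) \<Rightarrow> bool" where
  "valid_decision_seq M \<omega> \<X> X \<longleftrightarrow>
     (\<forall>t. (\<forall>s\<in>space M. X t s \<in> \<X>) \<and> indep_rv M (X t) (\<omega> t))"

definition expected_value ::
    "'s measure \<Rightarrow> (nat \<Rightarrow> 's \<Rightarrow> 'w) \<Rightarrow> ('x \<Rightarrow> 'w \<Rightarrow> real) \<Rightarrow> (nat \<Rightarrow> 's \<Rightarrow> 'x) \<Rightarrow> nat \<Rightarrow> real" where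
  "expected_value M \<omega> h X t = (\<integral>s. h (X t s) (\<omega> t s) \<partial>M)"

definition time_average :: "(nat \<Rightarrow> real) \<Rightarrow> nat \<Rightarrow> real" where
  "time_average a T = (1 / real T) * (\<Sum>t<T. a t)"

definition feasible_seq ::
    "'s measure \<Rightarrow> (nat \<Rightarrow> 's \<Rightarrow> 'w::euclidean_space) \<Rightarrow> (real ^ 'n) set \<Rightarrow> nat
      \<Rightarrow> (nat \<Rightarrow> real ^ 'n \<Rightarrow> 'w \<Rightarrow> real) \<Rightarrow> (nat \<Rightarrow> 's \<Rightarrow> real ^ 'n) \<Rightarrow> bool" where
  "feasible_seq M \<omega> \<X> k ghat X \<longleftrightarrow>
     valid_decision_seq M \<omega> \<X> X \<and>
     (\<forall>i\<in>{1..k}. limsup (\<lambda>T. ereal (time_average (expected_value M \<omega> (ghat i) X) T)) \<le> 0)"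

definition optimal_value ::
    "'s measure \<Rightarrow> (nat \<Rightarrow> 's \<Rightarrow> 'w::euclidean_space) \<Rightarrow> (real ^ 'n) set \<Rightarrow> nat
      \<Rightarrow> (real ^ 'n \<Rightarrow> 'w \<Rightarrow> real) \<Rightarrow> (nat \<Rightarrow> real ^ 'n \<Rightarrow> 'w \<Rightarrow> real) \<Rightarrow> ereal" where
  "optimal_value M \<omega> \<X> k fhat ghat =
     (INF X\<in>{X. feasible_seq M \<omega> \<X> k ghat X}.
        limsup (\<lambda>T. ereal (time_average (expected_value M \<omega> fhat X) T)))"

definition lagrange_multipliers ::
    "'s measure \<Rightarrow> (nat \<Rightarrow> 's \<Rightarrow> 'w::euclidean_space) \<Rightarrow> (real ^ 'n) set \<Rightarrow> nat
      \<Rightarrow> (real ^ 'n \<Rightarrow> 'w \<Rightarrow> real) \<Rightarrow> (nat \<Rightarrow> real ^ 'n \<Rightarrow> 'w \<Rightarrow> real) \<Rightarrow> (nat \<Rightarrow> real) \<Rightarrow> bool" where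
  "lagrange_multipliers M \<omega> \<X> k fhat ghat \<mu> \<longleftrightarrow>
     (\<forall>i\<in>{1..k}. \<mu> i \<ge> 0) \<and>
     (\<forall>X t. valid_decision_seq M \<omega> \<X> X \<longrightarrow>
        ereal (expected_value M \<omega> fhat X t + (\<Sum>i=1..k. \<mu> i * expected_value M \<omega> (ghat i) X t))
          \<ge> optimal_value M \<omega> \<X> k fhat ghat)"

text \<open>
  The algorithm is described as a relation: \<open>X t s\<close> and \<open>Q i t s\<close> are the decision and the virtual
  queue values of slot \<open>t\<close> at the sample point \<open>s\<close>. No measurability or independence is built in.
\<close>

definition algorithm_run ::
    "'s measure \<Rightarrow> (nat \<Rightarrow> 's \<Rightarrow> 'w) \<Rightarrow> (real ^ 'n) set \<Rightarrow> nat
      \<Rightarrow> (nat \<Rightarrow> real ^ 'n \<Rightarrow> 'w \<Rightarrow> real)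
      \<Rightarrow> (nat \<Rightarrow> real ^ 'n \<Rightarrow> 'w \<Rightarrow> real ^ 'n) \<Rightarrow> (nat \<Rightarrow> nat \<Rightarrow> real ^ 'n \<Rightarrow> 'w \<Rightarrow> real ^ 'n)
      \<Rightarrow> real ^ 'n \<Rightarrow> real \<Rightarrow> real
      \<Rightarrow> (nat \<Rightarrow> 's \<Rightarrow> real ^ 'n) \<Rightarrow> (nat \<Rightarrow> nat \<Rightarrow> 's \<Rightarrow> real) \<Rightarrow> bool" where
  "algorithm_run M \<omega> \<X> k ghat fsub gsub x0 V \<alpha> X Q \<longleftrightarrow>
     (\<forall>s\<in>space M.
        X 0 s = x0 \<and>
        (\<forall>i\<in>{1..k}. Q i 0 s = 0 \<and> Q i 1 s = 0) \<and>
        (\<forall>t\<ge>1. \<forall>i\<in>{1..k}.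
           Q i (t + 1) s =
             max (Q i t s + ghat i (X (t - 1) s) (\<omega> (t - 1) s)
                    + gsub (t - 1) i (X (t - 1) s) (\<omega> (t - 1) s) \<bullet> (X t s - X (t - 1) s)) 0) \<and>
        (\<forall>t\<ge>1.
           is_arg_min
             (\<lambda>x. (V *\<^sub>R fsub (t - 1) (X (t - 1) s) (\<omega> (t - 1) s)
                     + (\<Sum>i=1..k. Q i t s *\<^sub>R gsub (t - 1) i (X (t - 1) s) (\<omega> (t - 1) s))) \<bullet> x
                  + \<alpha> * (norm (x - X (t - 1) s))\<^sup>2)
             (\<lambda>x. x \<in> \<X>) (X t s)))"

end

theory Submission
  imports Defs
begin

text \<open>
  The proof is a drift-plus-penalty argument that is carried out along each sample path and then
  averaged. Let \<open>L(t)\<close> be half the sum of the squared queues. A decision minimises a linear function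
  plus \<open>\<alpha>\<close> times a squared distance, so it beats every fixed competitor \<open>x\<close> by a margin of \<open>\<alpha>\<close> times
  the squared distance to \<open>x\<close>. Together with the subgradient inequalities this bounds
  \<open>L(t + 2) - L(t + 1) + V f\<^sub>t(X\<^sub>t)\<close> by a constant, by \<open>V f\<^sub>t(x) + \<Sum>\<^sub>i Q\<^sub>i(t + 1) g\<^sub>t\<^sub>,\<^sub>i(x)\<close> and by a telescoping
  term (\<open>drift_plus_penalty_step\<close>). The decision \<open>X\<^sub>t\<close> and the queues \<open>Q\<^sub>i(t + 1)\<close> are functions of
  \<open>\<omega>\<^sub>0, \<dots>, \<omega>\<^sub>t\<^sub>-\<^sub>1\<close>, hence independent of \<open>\<omega>\<^sub>t\<close>, and the expectation of the product \<open>Q\<^sub>i(t + 1) g\<^sub>t\<^sub>,\<^sub>i(x)\<close>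
  factorises (\<open>expected_drift_plus_penalty\<close>). The outcome is an inequality
  \<open>K \<le> V T E f(x) + \<Sum>\<^sub>i S\<^sub>i E g\<^sub>i(x)\<close> with \<open>S\<^sub>i \<ge> 0\<close>, valid for every \<open>x\<close> in the decision set.

  The optimal value is an infimum over random decision sequences, and the link to it is
  \<open>optimal_value_lower_bound\<close>: the last inequality is averaged over the law of the decision of a
  feasible sequence, and then over time. In the limit the constraint terms become nonpositive, so that
  \<open>K \<le> V T f\<^sup>*\<close>. Averaging the inequality itself avoids exhibiting a single optimal deterministic decision.
  Dropping the nonnegative queue and displacement terms from \<open>K\<close> gives the objective bound.

  For the constraints, the definition of the queues shows that the accumulated constraint values are at
  most the final queue plus \<open>G\<close> times the length of the path of the decisions
  (\<open>cumulative_constraint_le\<close>). Both are controlled by the terms kept in \<open>K\<close>: the Lagrange multiplier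
  assumption, applied to the decisions of the algorithm, bounds the remaining objective gap
  \<open>f\<^sup>* - E f\<^sub>t(X\<^sub>t)\<close> by the multiplier-weighted constraint values, hence linearly by queues and
  displacements, and Young's inequality absorbs these linear terms into the quadratic ones
  (\<open>energy_bound\<close>). With \<open>V = 1/\<epsilon>\<close>, \<open>\<alpha> = 1/\<epsilon>\<^sup>2\<close> and \<open>T \<ge> 1/\<epsilon>\<^sup>2\<close> the second moment of a queue is
  of order \<open>T\<close> and that of a displacement is on average of order \<open>\<epsilon>\<^sup>2\<close>, which makes both first-order terms
  of order \<open>\<epsilon> T\<close>.
\<close>

section \<open>Joint measurability of functions continuous in one variable\<close>

text \<open>
  Approximating the first argument by simple functions turns the composition into a countable case
  distinction over functions of the second argument; continuity lets one pass to the limit. Projecting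
  the approximations onto \<open>S\<close> keeps them where \<open>h\<close> is continuous and gives a function on the whole
  product space.
\<close>

lemma borel_measurable_caratheodory:
  fixes h :: "'a::euclidean_space \<Rightarrow> 'w \<Rightarrow> real"
  assumes S: "convex S" "closed S" "S \<noteq> {}"
    and cont: "\<And>w. w \<in> space N \<Longrightarrow> continuous_on S (\<lambda>x. h x w)"
    and meas: "\<And>x. x \<in> S \<Longrightarrow> h x \<in> borel_measurable N"
  shows "(\<lambda>p. h (closest_point S (fst p)) (snd p)) \<in> borel_measurable (borel \<Otimes>\<^sub>M N)"
proof -
  \<comment> \<open>The library's sequence also satisfies a growth bound relative to a reference point; any point serves.\<close>
  obtain q :: "nat \<Rightarrow> 'a \<Rightarrow> 'a"
    where simple: "\<And>i. simple_function borel (q i)" and lim: "\<And>x. (\<lambda>i. q i x) \<longlonglongrightarrow> x"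
    using borel_measurable_implies_sequence_metric[of "\<lambda>x::'a. x" borel undefined] by auto
  have in_S: "closest_point S y \<in> S" for y
    using closest_point_in_set S by blast
  have approx: "(\<lambda>p. h (closest_point S (q i (fst p))) (snd p)) \<in> borel_measurable (borel \<Otimes>\<^sub>M N)" for i
  proof (rule measurable_compose_countable'[where I = "range (q i)"
        and f = "\<lambda>c p. h (closest_point S c) (snd p)" and g = "\<lambda>p::'a \<times> 'w. q i (fst p)"])
    show "(\<lambda>p. h (closest_point S c) (snd p)) \<in> borel_measurable (borel \<Otimes>\<^sub>M N)" for c
      by (rule measurable_compose[OF measurable_snd meas[OF in_S]])
    have "q i \<in> borel \<rightarrow>\<^sub>M count_space (range (q i))"
      using simple[of i] by (auto simp: simple_function_def measurable_count_space_eq2)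
    then show "(\<lambda>p. q i (fst p)) \<in> (borel \<Otimes>\<^sub>M N) \<rightarrow>\<^sub>M count_space (range (q i))"
      by measurable
    show "countable (range (q i))"
      using simple[of i] by (simp add: simple_function_def countable_finite)
  qed
  show ?thesis
  proof (rule borel_measurable_LIMSEQ_real[OF _ approx])
    fix p :: "'a \<times> 'w" assume "p \<in> space (borel \<Otimes>\<^sub>M N)"
    then have "snd p \<in> space N" by (auto simp: space_pair_measure)
    moreover have "(\<lambda>i. closest_point S (q i (fst p))) \<longlonglongrightarrow> closest_point S (fst p)"
      by (rule isCont_tendsto_compose[OF continuous_at_closest_point[OF S] lim])
    ultimately show "(\<lambda>i. h (closest_point S (q i (fst p))) (snd p)) \<longlonglongrightarrow> h (closest_point S (fst p)) (snd p)"
      by (intro continuous_on_tendsto_compose[OF cont]) (simp_all add: in_S)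
  qed
qed

section \<open>Independence of the past and the present\<close>

text \<open>
  The \<open>\<sigma>\<close>-algebra generated by \<open>\<omega> 0, \<dots>, \<omega> (t - 1)\<close>. Stating that a quantity is determined by the past as
  measurability with respect to this algebra lets an induction over the slots use the ordinary
  closure properties of measurable functions.
\<close>

definition history ::
    "'s measure \<Rightarrow> (nat \<Rightarrow> 's \<Rightarrow> 'w::topological_space) \<Rightarrow> nat \<Rightarrow> 's measure" where
  "history M \<omega> t =
     vimage_algebra (space M) (\<lambda>s. \<lambda>j\<in>{..<t}. \<omega> j s) (PiM {..<t} (\<lambda>_. borel))"

lemma space_history [simp]: "space (history M \<omega> t) = space M"
  by (simp add: history_def)

lemma measurable_history:
  assumes "j < t"
  shows "\<omega> j \<in> borel_measurable (history M \<omega> t)"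
proof -
  have "(\<lambda>s. \<lambda>j\<in>{..<t}. \<omega> j s) \<in> history M \<omega> t \<rightarrow>\<^sub>M PiM {..<t} (\<lambda>_. borel)"
    unfolding history_def by (rule measurable_vimage_algebra1) (auto simp: space_PiM)
  then have "(\<lambda>s. (\<lambda>j\<in>{..<t}. \<omega> j s) j) \<in> borel_measurable (history M \<omega> t)"
    by (rule measurable_compose) (use assms in simp)
  then show ?thesis using assms by simp
qed

lemma subalgebra_history:
  assumes "space N = space M" and "\<And>j. j < t \<Longrightarrow> \<omega> j \<in> borel_measurable N"
  shows "subalgebra N (history M \<omega> t)"
proof -
  have "(\<lambda>s. \<lambda>j\<in>{..<t}. \<omega> j s) \<in> N \<rightarrow>\<^sub>M PiM {..<t} (\<lambda>_. borel)"
    by (rule measurable_restrict) (simp add: assms)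
  then show ?thesis
    using sets_image_in_sets[OF assms(1)] by (simp add: subalgebra_def history_def assms(1))
qed

lemma measurable_history_Suc:
  "Y \<in> history M \<omega> t \<rightarrow>\<^sub>M N \<Longrightarrow> Y \<in> history M \<omega> (Suc t) \<rightarrow>\<^sub>M N"
  by (rule measurable_from_subalg[OF subalgebra_history]) (auto intro: measurable_history)

context prob_space
begin

lemma integrable_bounded:
  fixes Y :: "'a \<Rightarrow> real"
  assumes "Y \<in> borel_measurable M" "\<And>s. s \<in> space M \<Longrightarrow> \<bar>Y s\<bar> \<le> B"
  shows "integrable M Y"
  by (rule integrable_const_bound[of _ B]) (use assms in auto)

text \<open>
  Young's inequality \<open>r y \<le> c y\<^sup>2 + r\<^sup>2 / (4 c)\<close> under the expectation. It trades a first moment for a second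
  moment, which is how queues and displacements are compared with the quadratic terms of the drift bound.
\<close>

lemma expectation_young:
  fixes Y :: "'a \<Rightarrow> real"
  assumes "integrable M Y" "integrable M (\<lambda>s. (Y s)\<^sup>2)" "c > 0"
  shows "r * expectation Y \<le> c * expectation (\<lambda>s. (Y s)\<^sup>2) + r\<^sup>2 / (4 * c)"
proof -
  have "r * y \<le> c * y\<^sup>2 + r\<^sup>2 / (4 * c)" for y
  proof -
    have "0 \<le> (2 * c * y - r)\<^sup>2 / (4 * c)" using \<open>c > 0\<close> by simp
    then show ?thesis
      using \<open>c > 0\<close> by (simp add: power2_diff power_mult_distrib field_simps power2_eq_square)
  qed
  then have "expectation (\<lambda>s. r * Y s) \<le> expectation (\<lambda>s. c * (Y s)\<^sup>2 + r\<^sup>2 / (4 * c))"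
    using assms(1,2) by (intro integral_mono) auto
  then show ?thesis using assms(1,2) by (simp add: prob_space)
qed

text \<open>
  The random variables have different value types, so that the characterisation of \<open>indep_var\<close> by
  product distributions does not apply; the two measures agree because they agree on rectangles.
\<close>

lemma indep_rv_distr_pair:
  assumes "indep_rv M X Y"
  shows "distr M (borel \<Otimes>\<^sub>M borel) (\<lambda>s. (X s, Y s)) = distr M borel X \<Otimes>\<^sub>M distr M borel Y"
proof -
  have [measurable]: "X \<in> borel_measurable M" "Y \<in> borel_measurable M"
    and indep: "indep_set (sigma_sets (space M) {X -` A \<inter> space M |A. A \<in> sets borel})
       (sigma_sets (space M) {Y -` A \<inter> space M |A. A \<in> sets borel})"
    using assms by (auto simp: indep_rv_def)
  interpret X: prob_space "distr M borel X" by (rule prob_space_distr) simp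
  interpret Y: prob_space "distr M borel Y" by (rule prob_space_distr) simp
  have "distr M borel X \<Otimes>\<^sub>M distr M borel Y = distr M (borel \<Otimes>\<^sub>M borel) (\<lambda>s. (X s, Y s))"
  proof (rule pair_measure_eqI)
    show "sigma_finite_measure (distr M borel X)" "sigma_finite_measure (distr M borel Y)"
      by unfold_locales
    show "sets (distr M borel X \<Otimes>\<^sub>M distr M borel Y) = sets (distr M (borel \<Otimes>\<^sub>M borel) (\<lambda>s. (X s, Y s)))"
      by simp
    fix A B assume "A \<in> sets (distr M borel X)" "B \<in> sets (distr M borel Y)"
    then have [measurable]: "A \<in> sets borel" "B \<in> sets borel" by auto
    have "prob ((X -` A \<inter> space M) \<inter> (Y -` B \<inter> space M)) = prob (X -` A \<inter> space M) * prob (Y -` B \<inter> space M)"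
      by (rule indep_setD[OF indep]) (auto intro!: sigma_sets.Basic)
    moreover have "(\<lambda>s. (X s, Y s)) -` (A \<times> B) \<inter> space M = (X -` A \<inter> space M) \<inter> (Y -` B \<inter> space M)"
      by auto
    ultimately show "emeasure (distr M borel X) A * emeasure (distr M borel Y) B
        = emeasure (distr M (borel \<Otimes>\<^sub>M borel) (\<lambda>s. (X s, Y s))) (A \<times> B)"
      by (simp add: emeasure_distr emeasure_eq_measure ennreal_mult)
  qed
  then show ?thesis by simp
qed

text \<open>
  Fubini's theorem for the product distribution of the pair, with both integrals pulled back to \<open>M\<close>.
\<close>

lemma expectation_indep_rv:
  fixes h :: "'b::topological_space \<times> 'c::topological_space \<Rightarrow> real"
  assumes indep: "indep_rv M X Y"
    and h [measurable]: "h \<in> borel_measurable (borel \<Otimes>\<^sub>M borel)"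
    and bounded: "\<And>p. \<bar>h p\<bar> \<le> B"
  shows "expectation (\<lambda>s. h (X s, Y s)) = expectation (\<lambda>s. expectation (\<lambda>s'. h (X s, Y s')))"
proof -
  have [measurable]: "X \<in> borel_measurable M" "Y \<in> borel_measurable M"
    using indep by (auto simp: indep_rv_def)
  interpret X: prob_space "distr M borel X" by (rule prob_space_distr) simp
  interpret Y: prob_space "distr M borel Y" by (rule prob_space_distr) simp
  interpret P: pair_prob_space "distr M borel X" "distr M borel Y" by unfold_locales
  have sets: "sets (distr M borel X \<Otimes>\<^sub>M distr M borel Y) = sets (borel \<Otimes>\<^sub>M borel)"
    by (intro sets_pair_measure_cong) simp_all
  have int: "integrable (distr M borel X \<Otimes>\<^sub>M distr M borel Y) h"
    by (rule P.P.integrable_const_bound[of _ B])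
      (use bounded in \<open>auto simp: measurable_cong_sets[OF sets refl]\<close>)
  have "expectation (\<lambda>s. h (X s, Y s)) = (\<integral>p. h p \<partial>distr M (borel \<Otimes>\<^sub>M borel) (\<lambda>s. (X s, Y s)))"
    by (subst integral_distr) simp_all
  also have "\<dots> = (\<integral>x. \<integral>y. h (x, y) \<partial>distr M borel Y \<partial>distr M borel X)"
    unfolding indep_rv_distr_pair[OF indep] by (rule P.integral_fst'[OF int, symmetric])
  also have "\<dots> = (\<integral>x. expectation (\<lambda>s'. h (x, Y s')) \<partial>distr M borel X)"
    by (intro Bochner_Integration.integral_cong refl integral_distr) simp_all
  also have "\<dots> = expectation (\<lambda>s. expectation (\<lambda>s'. h (X s, Y s')))"
    by (intro integral_distr) simp_all
  finally show ?thesis .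
qed

lemma expectation_indep_rv_mult:
  fixes X :: "'a \<Rightarrow> real" and v :: "'c::topological_space \<Rightarrow> real"
  assumes indep: "indep_rv M X Y"
    and v [measurable]: "v \<in> borel_measurable borel"
    and int: "integrable M X" "integrable M (\<lambda>s. v (Y s))"
  shows "expectation (\<lambda>s. X s * v (Y s)) = expectation X * expectation (\<lambda>s. v (Y s))"
proof -
  have [measurable]: "X \<in> borel_measurable M" "Y \<in> borel_measurable M"
    and indep': "indep_set (sigma_sets (space M) {X -` A \<inter> space M |A. A \<in> sets borel})
       (sigma_sets (space M) {Y -` A \<inter> space M |A. A \<in> sets borel})"
    using indep by (auto simp: indep_rv_def)
  have sub: "sigma_sets (space M) {(\<lambda>s. v (Y s)) -` A \<inter> space M |A. A \<in> sets borel}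
      \<subseteq> sigma_sets (space M) {Y -` A \<inter> space M |A. A \<in> sets borel}"
  proof (rule sigma_sets_mono', safe)
    fix A :: "real set" assume [measurable]: "A \<in> sets borel"
    have "(\<lambda>s. v (Y s)) -` A \<inter> space M = Y -` (v -` A) \<inter> space M" by auto
    moreover have "v -` A \<in> sets borel" using measurable_sets[OF v, of A] by simp
    ultimately show "\<exists>B. (\<lambda>s. v (Y s)) -` A \<inter> space M = Y -` B \<inter> space M \<and> B \<in> sets borel"
      by blast
  qed
  have "indep_var borel X borel (\<lambda>s. v (Y s))"
    unfolding indep_var_eq using indep' sub by (auto simp: indep_sets2_eq)
  then show ?thesis by (rule indep_var_lebesgue_integral) (fact int)+
qed

text \<open>
  The restrictions of an independent family to the disjoint index sets \<open>{..<t}\<close> and \<open>{t}\<close> are independent,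
  and the \<open>\<sigma>\<close>-algebras of \<open>X\<close> and \<open>\<omega> t\<close> are contained in those of the two restrictions.
\<close>

lemma indep_rv_history:
  fixes \<omega> :: "nat \<Rightarrow> 'a \<Rightarrow> 'w::topological_space"
  assumes \<omega>: "indep_vars (\<lambda>_. borel) \<omega> UNIV"
    and X: "X \<in> borel_measurable (history M \<omega> t)"
  shows "indep_rv M X (\<omega> t)"
proof -
  let ?past = "\<lambda>s. \<lambda>j\<in>{..<t}. \<omega> j s" and ?now = "\<lambda>s. \<lambda>j\<in>{t}. \<omega> j s"
  have [measurable]: "\<omega> j \<in> borel_measurable M" for j
    using \<omega> by (auto simp: indep_vars_def)
  have "indep_var (PiM {..<t} (\<lambda>_. borel)) ?past (PiM {t} (\<lambda>_. borel)) ?now"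
    by (rule indep_var_restrict[OF \<omega>]) auto
  then have indep: "indep_set (sigma_sets (space M) {?past -` A \<inter> space M |A. A \<in> sets (PiM {..<t} (\<lambda>_. borel))})
     (sigma_sets (space M) {?now -` A \<inter> space M |A. A \<in> sets (PiM {t} (\<lambda>_. borel))})"
    unfolding indep_var_eq by auto
  have now: "sigma_sets (space M) {\<omega> t -` A \<inter> space M |A. A \<in> sets borel}
      \<subseteq> sigma_sets (space M) {?now -` A \<inter> space M |A. A \<in> sets (PiM {t} (\<lambda>_. borel))}"
  proof (rule sigma_sets_mono', safe)
    fix A :: "'w set" assume [measurable]: "A \<in> sets borel"
    have "\<omega> t -` A \<inter> space M = ?now -` (Pi\<^sub>E {t} (\<lambda>_. A)) \<inter> space M"
      by (auto simp: PiE_iff extensional_def)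
    moreover have "Pi\<^sub>E {t} (\<lambda>_. A) \<in> sets (PiM {t} (\<lambda>_. borel))"
      by (rule sets_PiM_I_finite) auto
    ultimately show "\<exists>B. \<omega> t -` A \<inter> space M = ?now -` B \<inter> space M \<and> B \<in> sets (PiM {t} (\<lambda>_. borel))"
      by blast
  qed
  have past: "sigma_sets (space M) {X -` A \<inter> space M |A. A \<in> sets borel}
      \<subseteq> sigma_sets (space M) {?past -` A \<inter> space M |A. A \<in> sets (PiM {..<t} (\<lambda>_. borel))}"
  proof (rule sigma_sets_mono, safe)
    fix A :: "'b set" assume A: "A \<in> sets borel"
    show "X -` A \<inter> space M \<in> sigma_sets (space M) {?past -` A \<inter> space M |A. A \<in> sets (PiM {..<t} (\<lambda>_. borel))}"
      using measurable_sets[OF X A] by (simp add: history_def sets_vimage_algebra)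
  qed
  have "X \<in> borel_measurable M"
    by (rule measurable_from_subalg[OF subalgebra_history X]) simp_all
  moreover have "indep_set (sigma_sets (space M) {X -` A \<inter> space M |A. A \<in> sets borel})
      (sigma_sets (space M) {\<omega> t -` A \<inter> space M |A. A \<in> sets borel})"
    using indep past now unfolding indep_sets2_eq by blast
  ultimately show ?thesis
    by (simp add: indep_rv_def)
qed

end

section \<open>The proximal step\<close>

text \<open>
  Completing the square shows that the objective is \<open>\<alpha>\<close> times the squared distance to
  \<open>y - c / (2 \<alpha>)\<close> up to a constant, so that \<open>p\<close> is the projection of that point. This makes the step
  a continuous function of its data, and the obtuse angle property of projections yields the margin
  \<open>\<alpha> \<parallel>x - p\<parallel>\<^sup>2\<close> in the inequality.
\<close>

lemma proximal_step:
  fixes c y p :: "'a::euclidean_space"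
  assumes S: "convex S" "closed S" and \<alpha>: "\<alpha> > 0"
    and min: "is_arg_min (\<lambda>x. c \<bullet> x + \<alpha> * (norm (x - y))\<^sup>2) (\<lambda>x. x \<in> S) p"
  shows proximal_step_eq_closest_point: "p = closest_point S (y - (1 / (2 * \<alpha>)) *\<^sub>R c)"
    and proximal_step_inequality: "\<And>x. x \<in> S \<Longrightarrow>
      c \<bullet> p + \<alpha> * (norm (p - y))\<^sup>2 + \<alpha> * (norm (x - p))\<^sup>2 \<le> c \<bullet> x + \<alpha> * (norm (x - y))\<^sup>2"
proof -
  define a where "a = y - (1 / (2 * \<alpha>)) *\<^sub>R c"
  have c: "c = (2 * \<alpha>) *\<^sub>R (y - a)"
    using \<alpha> by (simp add: a_def)
  have square: "c \<bullet> x + \<alpha> * (norm (x - y))\<^sup>2 = \<alpha> * (dist a x)\<^sup>2 + (\<alpha> * (y \<bullet> y) - \<alpha> * (a \<bullet> a))" for x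
    unfolding c dist_norm power2_norm_eq_inner
    by (simp add: inner_diff_left inner_diff_right inner_commute algebra_simps)
  have p: "p \<in> S" "\<forall>x\<in>S. dist a p \<le> dist a x"
  proof -
    show "p \<in> S" using min by (simp add: is_arg_min_def)
    show "\<forall>x\<in>S. dist a p \<le> dist a x"
    proof
      fix x assume "x \<in> S"
      then have "\<alpha> * (dist a p)\<^sup>2 \<le> \<alpha> * (dist a x)\<^sup>2"
        using min by (auto simp: is_arg_min_def square not_less)
      then show "dist a p \<le> dist a x" using \<alpha> by (simp add: power2_le_iff_abs_le)
    qed
  qed
  show "p = closest_point S (y - (1 / (2 * \<alpha>)) *\<^sub>R c)"
    using closest_point_unique[OF S p] by (simp add: a_def)
  fix x assume "x \<in> S"
  then have "(a - p) \<bullet> (x - p) \<le> 0"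
    using any_closest_point_dot[OF S p(1) _ p(2)] by blast
  then have "\<alpha> * ((a - p) \<bullet> (x - p)) \<le> 0" using \<alpha> by (simp add: mult_nonneg_nonpos)
  then show "c \<bullet> p + \<alpha> * (norm (p - y))\<^sup>2 + \<alpha> * (norm (x - p))\<^sup>2 \<le> c \<bullet> x + \<alpha> * (norm (x - y))\<^sup>2"
    unfolding c power2_norm_eq_inner
    by (simp add: inner_diff_left inner_diff_right inner_commute algebra_simps)
qed

section \<open>Expected costs and the optimal value\<close>

context model2
begin

lemma closed_X: "closed \<X>"
  using compact_X by (rule compact_imp_closed)

lemma omega_measurable [measurable]: "\<omega> t \<in> borel_measurable M"
  using indep_omega by (auto simp: indep_vars_def)

text \<open>
  The properties that the objective and the constraint functions have in common, so that facts about
  expected values are proved once for all of them.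
\<close>

definition random_cost :: "(real ^ 'n \<Rightarrow> 'w \<Rightarrow> real) \<Rightarrow> bool" where
  "random_cost h \<longleftrightarrow>
     (\<forall>w. continuous_on \<X> (\<lambda>x. h x w)) \<and> (\<forall>x\<in>\<X>. h x \<in> borel_measurable borel) \<and>
     (\<forall>t. \<forall>s\<in>space M. \<forall>x\<in>\<X>. \<bar>h x (\<omega> t s)\<bar> \<le> F)"

lemma random_cost_f: "random_cost fhat"
  unfolding random_cost_def using f_continuous f_measurable f_bounded by auto

lemma random_cost_g: "i \<in> {1..k} \<Longrightarrow> random_cost (ghat i)"
  unfolding random_cost_def using g_continuous g_measurable g_bounded by auto

definition mean_cost :: "(real ^ 'n \<Rightarrow> 'w \<Rightarrow> real) \<Rightarrow> real ^ 'n \<Rightarrow> real" where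
  "mean_cost h x = expectation (\<lambda>s. h x (\<omega> 0 s))"

lemma random_cost_measurable:
  assumes h: "random_cost h"
    and Y: "Y \<in> borel_measurable N" "\<And>s. s \<in> space N \<Longrightarrow> Y s \<in> \<X>"
    and W: "W \<in> borel_measurable N"
  shows "(\<lambda>s. h (Y s) (W s)) \<in> borel_measurable N"
proof (cases "\<X> = {}")
  case True
  then have "space N = {}" using Y(2) by auto
  then show ?thesis by (simp add: measurable_def)
next
  case False
  have "(\<lambda>p. h (closest_point \<X> (fst p)) (snd p)) \<in> borel_measurable (borel \<Otimes>\<^sub>M borel)"
    by (rule borel_measurable_caratheodory[OF convex_X closed_X False])
      (use h in \<open>auto simp: random_cost_def\<close>)
  from measurable_compose[OF measurable_Pair[OF Y(1) W] this]
  have "(\<lambda>s. h (closest_point \<X> (Y s)) (W s)) \<in> borel_measurable N"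
    by simp
  moreover have "h (closest_point \<X> (Y s)) (W s) = h (Y s) (W s)" if "s \<in> space N" for s
    using Y(2)[OF that] by (simp add: closest_point_self)
  ultimately show ?thesis
    by (simp cong: measurable_cong)
qed

lemma expectation_random_cost:
  assumes h: "random_cost h" and x: "x \<in> \<X>"
  shows "expectation (\<lambda>s. h x (\<omega> t s)) = mean_cost h x"
proof -
  have [measurable]: "h x \<in> borel_measurable borel"
    using h x by (auto simp: random_cost_def)
  have "expectation (\<lambda>s. h x (\<omega> t s)) = (\<integral>w. h x w \<partial>distr M borel (\<omega> t))"
    by (subst integral_distr) simp_all
  also have "\<dots> = (\<integral>w. h x w \<partial>distr M borel (\<omega> 0))"
    by (simp add: ident_omega[of t])
  also have "\<dots> = mean_cost h x"
    unfolding mean_cost_def by (subst integral_distr) simp_all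
  finally show ?thesis .
qed

lemma integrable_random_cost:
  assumes h: "random_cost h" and Y: "Y \<in> borel_measurable M" "\<And>s. s \<in> space M \<Longrightarrow> Y s \<in> \<X>"
  shows "integrable M (\<lambda>s. h (Y s) (\<omega> t s))"
  by (rule integrable_bounded[OF random_cost_measurable[OF h Y], of _ F])
    (use h Y in \<open>auto simp: random_cost_def\<close>)

text \<open>
  Independence of the decision and \<open>\<omega> t\<close> allows integrating over \<open>\<omega> t\<close> first, with the decision held
  fixed.
\<close>

lemma mean_cost_valid_decision:
  assumes h: "random_cost h" and Y: "valid_decision_seq M \<omega> \<X> Y"
  shows integrable_mean_cost: "integrable M (\<lambda>s. mean_cost h (Y t s))"
    and expected_value_eq: "expected_value M \<omega> h Y t = expectation (\<lambda>s. mean_cost h (Y t s))"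
proof -
  have Y_in: "Y t s \<in> \<X>" if "s \<in> space M" for s
    using Y that by (auto simp: valid_decision_seq_def)
  have indep: "indep_rv M (Y t) (\<omega> t)"
    using Y by (auto simp: valid_decision_seq_def)
  then have [measurable]: "Y t \<in> borel_measurable M"
    by (auto simp: indep_rv_def)
  have nonempty: "\<X> \<noteq> {}"
    using Y_in not_empty by blast
  \<comment> \<open>Projecting and truncating extends \<open>h\<close> to a bounded function on the whole product space
    without changing its values along the sample paths.\<close>
  define h' where "h' = (\<lambda>p. max (-F) (min F (h (closest_point \<X> (fst p)) (snd p))))"
  have "(\<lambda>p. h (closest_point \<X> (fst p)) (snd p)) \<in> borel_measurable (borel \<Otimes>\<^sub>M borel)"
    by (rule borel_measurable_caratheodory[OF convex_X closed_X nonempty])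
      (use h in \<open>auto simp: random_cost_def\<close>)
  then have h' [measurable]: "h' \<in> borel_measurable (borel \<Otimes>\<^sub>M borel)"
    unfolding h'_def by simp
  have h'_eq: "h' (Y t s, \<omega> u s') = h (Y t s) (\<omega> u s')" if "s \<in> space M" "s' \<in> space M" for u s s'
  proof -
    have "\<bar>h (Y t s) (\<omega> u s')\<bar> \<le> F"
      using h Y_in that by (auto simp: random_cost_def)
    then show ?thesis
      by (simp add: h'_def closest_point_self Y_in that)
  qed
  have h'_bounded: "\<bar>h' p\<bar> \<le> F" for p
    using F_nonneg by (auto simp: h'_def)
  have mean: "expectation (\<lambda>s'. h' (Y t s, \<omega> t s')) = mean_cost h (Y t s)" if "s \<in> space M" for s
  proof -
    have "expectation (\<lambda>s'. h' (Y t s, \<omega> t s')) = expectation (\<lambda>s'. h (Y t s) (\<omega> t s'))"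
      by (rule Bochner_Integration.integral_cong) (simp_all add: h'_eq that)
    then show ?thesis
      by (simp add: expectation_random_cost[OF h Y_in[OF that]])
  qed
  have "integrable M (\<lambda>s. expectation (\<lambda>s'. h' (Y t s, \<omega> t s')))"
  proof (rule integrable_bounded)
    show "(\<lambda>s. expectation (\<lambda>s'. h' (Y t s, \<omega> t s'))) \<in> borel_measurable M"
      by measurable
    fix s
    assume "s \<in> space M"
    then have "integrable M (\<lambda>s'. h' (Y t s, \<omega> t s'))"
      by (intro integrable_bounded[OF _ h'_bounded]) simp
    then have "\<bar>expectation (\<lambda>s'. h' (Y t s, \<omega> t s'))\<bar> \<le> expectation (\<lambda>s'. F)"
      by (intro order_trans[OF integral_abs_bound] integral_mono) (simp_all add: h'_bounded)
    then show "\<bar>expectation (\<lambda>s'. h' (Y t s, \<omega> t s'))\<bar> \<le> F"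
      by (simp add: prob_space)
  qed
  then show "integrable M (\<lambda>s. mean_cost h (Y t s))"
    by (simp add: mean cong: Bochner_Integration.integrable_cong)
  have "expected_value M \<omega> h Y t = expectation (\<lambda>s. h' (Y t s, \<omega> t s))"
    unfolding expected_value_def by (rule Bochner_Integration.integral_cong) (simp_all add: h'_eq)
  also have "\<dots> = expectation (\<lambda>s. expectation (\<lambda>s'. h' (Y t s, \<omega> t s')))"
    by (rule expectation_indep_rv[OF indep h' h'_bounded])
  also have "\<dots> = expectation (\<lambda>s. mean_cost h (Y t s))"
    by (rule Bochner_Integration.integral_cong) (simp_all add: mean)
  finally show "expected_value M \<omega> h Y t = expectation (\<lambda>s. mean_cost h (Y t s))" .
qed

text \<open>
  Substituting the decisions of a feasible sequence for \<open>x\<close> and taking expectations gives the bound for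
  the expected costs of every slot, hence for their time averages. Since the weights \<open>S i\<close> are nonnegative
  and the averaged constraints are eventually below any positive number, the objective of the sequence is
  at least \<open>K / a\<close>.
\<close>

lemma optimal_value_lower_bound:
  fixes a K :: real and S :: "nat \<Rightarrow> real"
  assumes a: "a > 0" and S: "\<And>i. i \<in> {1..k} \<Longrightarrow> S i \<ge> 0"
    and bound: "\<And>x. x \<in> \<X> \<Longrightarrow> K \<le> a * mean_cost fhat x + (\<Sum>i=1..k. S i * mean_cost (ghat i) x)"
  shows "ereal (K / a) \<le> optimal_value M \<omega> \<X> k fhat ghat"
  unfolding optimal_value_def
proof (rule INF_greatest, rule ccontr)
  fix Y assume "Y \<in> {X. feasible_seq M \<omega> \<X> k ghat X}"
  then have valid: "valid_decision_seq M \<omega> \<X> Y"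
    and feas: "\<And>i. i \<in> {1..k} \<Longrightarrow>
      limsup (\<lambda>T. ereal (time_average (expected_value M \<omega> (ghat i) Y) T)) \<le> 0"
    by (auto simp: feasible_seq_def)
  define e where "e = expected_value M \<omega> fhat Y"
  define eg where "eg i = expected_value M \<omega> (ghat i) Y" for i
  have slot: "K \<le> a * e t + (\<Sum>i=1..k. S i * eg i t)" for t
  proof -
    have int: "integrable M (\<lambda>s. a * mean_cost fhat (Y t s))"
      "\<And>i. i \<in> {1..k} \<Longrightarrow> integrable M (\<lambda>s. S i * mean_cost (ghat i) (Y t s))"
      by (intro integrable_mult_right integrable_mean_cost valid random_cost_f random_cost_g; assumption)+
    have int_sum: "integrable M (\<lambda>s. \<Sum>i=1..k. S i * mean_cost (ghat i) (Y t s))"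
      by (rule Bochner_Integration.integrable_sum) (rule int(2))
    have "expectation (\<lambda>s. K)
        \<le> expectation (\<lambda>s. a * mean_cost fhat (Y t s) + (\<Sum>i=1..k. S i * mean_cost (ghat i) (Y t s)))"
    proof (rule integral_mono)
      fix s assume "s \<in> space M"
      then have "Y t s \<in> \<X>" using valid by (auto simp: valid_decision_seq_def)
      then show "K \<le> a * mean_cost fhat (Y t s) + (\<Sum>i=1..k. S i * mean_cost (ghat i) (Y t s))"
        by (rule bound)
    qed (simp, intro Bochner_Integration.integrable_add int int_sum)
    also have "\<dots> = expectation (\<lambda>s. a * mean_cost fhat (Y t s))
        + (\<Sum>i=1..k. expectation (\<lambda>s. S i * mean_cost (ghat i) (Y t s)))"
      by (subst Bochner_Integration.integral_add[OF int(1) int_sum],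
          subst Bochner_Integration.integral_sum[OF int(2)]) simp_all
    also have "\<dots> = a * e t + (\<Sum>i=1..k. S i * eg i t)"
      unfolding e_def eg_def expected_value_eq[OF random_cost_f valid]
      by (intro arg_cong2[where f = "(+)"] sum.cong refl integral_mult_right_zero)
        (simp add: expected_value_eq[OF random_cost_g valid])
    finally show ?thesis by (simp add: prob_space)
  qed
  have average: "K \<le> a * time_average e N + (\<Sum>i=1..k. S i * time_average (eg i) N)" if "N \<ge> 1" for N
  proof -
    have total: "(\<Sum>t<N. u t) = real N * time_average u N" for u
      using that by (simp add: time_average_def)
    have "real N * K = (\<Sum>t<N. K)" by simp
    also have "\<dots> \<le> (\<Sum>t<N. a * e t + (\<Sum>i=1..k. S i * eg i t))"
      by (rule sum_mono) (rule slot)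
    also have "\<dots> = a * (\<Sum>t<N. e t) + (\<Sum>i=1..k. S i * (\<Sum>t<N. eg i t))"
      by (simp add: sum.distrib sum_distrib_left) (rule sum.swap)
    also have "\<dots> = real N * (a * time_average e N + (\<Sum>i=1..k. S i * time_average (eg i) N))"
      unfolding total by (simp add: distrib_left sum_distrib_left mult.left_commute)
    finally show ?thesis using that by simp
  qed
  assume "\<not> ereal (K / a) \<le> limsup (\<lambda>T. ereal (time_average (expected_value M \<omega> fhat Y) T))"
  then obtain r where r: "limsup (\<lambda>T. ereal (time_average e T)) < ereal r" "r < K / a"
    using ereal_dense2[of "limsup (\<lambda>T. ereal (time_average e T))" "ereal (K / a)"]
    by (auto simp: e_def not_le)
  \<comment> \<open>Small enough that constraint violations below \<open>\<delta>\<close>, weighted by the \<open>S i\<close>, do not close the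
    gap between \<open>a * r\<close> and \<open>K\<close>; the summand 1 guards against a vanishing sum.\<close>
  define \<delta> where "\<delta> = (K - a * r) / ((\<Sum>i=1..k. S i) + 1)"
  have S_sum: "(\<Sum>i=1..k. S i) \<ge> 0" using S by (rule sum_nonneg)
  have gap: "K - a * r > 0" using r(2) a by (simp add: field_simps)
  then have \<delta>: "\<delta> > 0" using S_sum by (simp add: \<delta>_def)
  have "\<forall>\<^sub>F T in sequentially. ereal (time_average e T) < ereal r"
    using Limsup_lessD[OF r(1)] by simp
  moreover have "\<forall>\<^sub>F T in sequentially. \<forall>i\<in>{1..k}. ereal (time_average (eg i) T) < ereal \<delta>"
  proof (rule eventually_ball_finite; safe?)
    fix i assume "i \<in> {1..k}"
    then have "limsup (\<lambda>T. ereal (time_average (eg i) T)) < ereal \<delta>"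
      using feas[of i] \<delta> by (auto simp: eg_def intro: le_less_trans)
    then show "\<forall>\<^sub>F T in sequentially. ereal (time_average (eg i) T) < ereal \<delta>"
      by (rule Limsup_lessD)
  qed
  moreover have "\<forall>\<^sub>F T in sequentially. (1::nat) \<le> T" by (rule eventually_ge_at_top)
  ultimately have "\<forall>\<^sub>F T in sequentially.
      time_average e T < r \<and> (\<forall>i\<in>{1..k}. time_average (eg i) T < \<delta>) \<and> 1 \<le> T"
    by eventually_elim auto
  then obtain N where N: "time_average e N < r" "\<And>i. i \<in> {1..k} \<Longrightarrow> time_average (eg i) N < \<delta>" "1 \<le> N"
    by (auto simp: eventually_sequentially)
  have "K \<le> a * time_average e N + (\<Sum>i=1..k. S i * time_average (eg i) N)"
    by (rule average[OF N(3)])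
  also have "\<dots> \<le> a * r + (\<Sum>i=1..k. S i * \<delta>)"
    using a S N by (intro add_mono sum_mono mult_left_mono) (auto intro: less_imp_le)
  also have "\<dots> = a * r + \<delta> * (\<Sum>i=1..k. S i)"
    by (simp add: sum_distrib_left mult.commute)
  also have "\<dots> < a * r + \<delta> * ((\<Sum>i=1..k. S i) + 1)"
    using \<delta> by simp
  also have "\<dots> = K" using S_sum by (simp add: \<delta>_def)
  finally show False by simp
qed

end

section \<open>Sample paths of the algorithm\<close>

locale online_run = model2 M \<omega> \<X> k fhat ghat fsub gsub D F G
  for M :: "'s measure"
    and \<omega> :: "nat \<Rightarrow> 's \<Rightarrow> 'w::euclidean_space"
    and \<X> :: "(real ^ 'n) set"
    and k fhat ghat fsub gsub D F G +
  fixes x0 :: "real ^ 'n" and V \<alpha> :: real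
    and X :: "nat \<Rightarrow> 's \<Rightarrow> real ^ 'n" and Q :: "nat \<Rightarrow> nat \<Rightarrow> 's \<Rightarrow> real"
  assumes x0_in: "x0 \<in> \<X>" and V_pos: "V > 0" and \<alpha>_pos: "\<alpha> > 0"
    and run: "algorithm_run M \<omega> \<X> k ghat fsub gsub x0 V \<alpha> X Q"
begin

lemma X_0: "s \<in> space M \<Longrightarrow> X 0 s = x0"
  and Q_1: "s \<in> space M \<Longrightarrow> i \<in> {1..k} \<Longrightarrow> Q i (Suc 0) s = 0"
  using run by (auto simp: algorithm_run_def)

lemma Q_step:
  assumes "s \<in> space M" "i \<in> {1..k}"
  shows "Q i (Suc (Suc t)) s = max (Q i (Suc t) s + ghat i (X t s) (\<omega> t s)
      + gsub t i (X t s) (\<omega> t s) \<bullet> (X (Suc t) s - X t s)) 0"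
proof -
  have "\<forall>t\<ge>1. \<forall>i\<in>{1..k}. Q i (t + 1) s =
      max (Q i t s + ghat i (X (t - 1) s) (\<omega> (t - 1) s)
        + gsub (t - 1) i (X (t - 1) s) (\<omega> (t - 1) s) \<bullet> (X t s - X (t - 1) s)) 0"
    using run assms(1) unfolding algorithm_run_def by blast
  from this[rule_format, of "Suc t" i] show ?thesis using assms(2) by simp
qed

definition weighted_subgradient :: "nat \<Rightarrow> 's \<Rightarrow> real ^ 'n" where
  "weighted_subgradient t s = V *\<^sub>R fsub t (X t s) (\<omega> t s)
     + (\<Sum>i=1..k. Q i (Suc t) s *\<^sub>R gsub t i (X t s) (\<omega> t s))"

lemma X_step:
  assumes "s \<in> space M"
  shows "is_arg_min (\<lambda>x. weighted_subgradient t s \<bullet> x + \<alpha> * (norm (x - X t s))\<^sup>2) (\<lambda>x. x \<in> \<X>) (X (Suc t) s)"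
proof -
  have "\<forall>t\<ge>1. is_arg_min
      (\<lambda>x. (V *\<^sub>R fsub (t - 1) (X (t - 1) s) (\<omega> (t - 1) s)
             + (\<Sum>i=1..k. Q i t s *\<^sub>R gsub (t - 1) i (X (t - 1) s) (\<omega> (t - 1) s))) \<bullet> x
          + \<alpha> * (norm (x - X (t - 1) s))\<^sup>2) (\<lambda>x. x \<in> \<X>) (X t s)"
    using run assms unfolding algorithm_run_def by blast
  from this[rule_format, of "Suc t"] show ?thesis
    by (simp add: weighted_subgradient_def)
qed

lemma X_in: "s \<in> space M \<Longrightarrow> X t s \<in> \<X>"
  using X_step[of s] X_0[of s] x0_in by (cases t) (auto simp: is_arg_min_def)

lemma linearized_constraint_bounded:
  assumes s: "s \<in> space M" and i: "i \<in> {1..k}"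
  shows "\<bar>ghat i (X t s) (\<omega> t s) + gsub t i (X t s) (\<omega> t s) \<bullet> (X (Suc t) s - X t s)\<bar> \<le> F + G * D"
proof -
  have "\<bar>gsub t i (X t s) (\<omega> t s) \<bullet> (X (Suc t) s - X t s)\<bar>
      \<le> norm (gsub t i (X t s) (\<omega> t s)) * norm (X (Suc t) s - X t s)"
    by (rule Cauchy_Schwarz_ineq2)
  also have "\<dots> \<le> G * D"
    by (intro mult_mono gsub_bounded diameter_X X_in s i) (use G_pos in auto)
  finally show ?thesis
    using g_bounded[OF i s X_in[OF s], of t t] by linarith
qed

lemma Q_nonneg: "s \<in> space M \<Longrightarrow> i \<in> {1..k} \<Longrightarrow> 0 \<le> Q i (Suc t) s"
  by (cases t) (simp_all add: Q_1 Q_step)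

lemma Q_le: "s \<in> space M \<Longrightarrow> i \<in> {1..k} \<Longrightarrow> Q i (Suc t) s \<le> real t * (F + G * D)"
proof (induction t)
  case (Suc t)
  have "0 \<le> F + G * D" using F_nonneg G_pos D_nonneg by simp
  then show ?case
    using Suc linearized_constraint_bounded[OF Suc.prems, of t] Q_nonneg[OF Suc.prems, of t]
    by (auto simp: Q_step algebra_simps)
qed (simp add: Q_1)

text \<open>
  The step from \<open>t\<close> to \<open>Suc t\<close> uses \<open>\<omega> t\<close>, the data of slot \<open>t\<close> and the projection formula for the new
  decision. Decisions of slot \<open>t\<close> are paired with queues of slot \<open>Suc t\<close> because the latter depend on
  \<open>\<omega> 0, \<dots>, \<omega> (t - 1)\<close> only.
\<close>

lemma run_measurable_history:
  shows X_measurable_history: "X t \<in> borel_measurable (history M \<omega> t)"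
    and Q_measurable_history: "i \<in> {1..k} \<Longrightarrow> Q i (Suc t) \<in> borel_measurable (history M \<omega> t)"
proof -
  have "X t \<in> borel_measurable (history M \<omega> t) \<and>
      (\<forall>i\<in>{1..k}. Q i (Suc t) \<in> borel_measurable (history M \<omega> t))"
  proof (induction t)
    case 0
    have "X 0 \<in> borel_measurable (history M \<omega> 0) \<longleftrightarrow> (\<lambda>_. x0) \<in> borel_measurable (history M \<omega> 0)"
      by (rule measurable_cong) (simp add: X_0)
    moreover have "Q i (Suc 0) \<in> borel_measurable (history M \<omega> 0) \<longleftrightarrow>
        (\<lambda>_. 0 :: real) \<in> borel_measurable (history M \<omega> 0)" if "i \<in> {1..k}" for i
      by (rule measurable_cong) (use Q_1 that in simp)
    ultimately show ?case by simp
  next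
    case (Suc t)
    let ?H = "history M \<omega> (Suc t)"
    have [measurable]: "X t \<in> borel_measurable ?H" "\<omega> t \<in> borel_measurable ?H"
      using Suc by (auto intro: measurable_history_Suc measurable_history)
    have Q_t [measurable]: "Q i (Suc t) \<in> borel_measurable ?H" if "i \<in> {1..k}" for i
      using Suc that by (auto intro: measurable_history_Suc)
    have pair: "(\<lambda>s. (X t s, \<omega> t s)) \<in> ?H \<rightarrow>\<^sub>M restrict_space borel \<X> \<Otimes>\<^sub>M borel"
      by (intro measurable_Pair measurable_restrict_space2) (auto simp: X_in)
    have fsub_t [measurable]: "(\<lambda>s. fsub t (X t s) (\<omega> t s)) \<in> borel_measurable ?H"
      using measurable_compose[OF pair fsub_measurable[of t]] by simp
    have gsub_t: "(\<lambda>s. gsub t i (X t s) (\<omega> t s)) \<in> borel_measurable ?H" if "i \<in> {1..k}" for i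
      using measurable_compose[OF pair gsub_measurable[of i t, OF that]] by simp
    have weighted_subgradient [measurable]: "weighted_subgradient t \<in> borel_measurable ?H"
      unfolding weighted_subgradient_def using Q_t gsub_t
      by (intro borel_measurable_add borel_measurable_sum borel_measurable_scaleR
          borel_measurable_const fsub_t) auto
    have "\<X> \<noteq> {}" using x0_in by auto
    then have "closest_point \<X> \<in> borel_measurable borel"
      by (intro borel_measurable_continuous_onI continuous_on_closest_point convex_X closed_X)
    then have "(\<lambda>s. closest_point \<X> (X t s - (1 / (2 * \<alpha>)) *\<^sub>R weighted_subgradient t s)) \<in> borel_measurable ?H"
      by (rule measurable_compose[rotated]) simp
    moreover have "X (Suc t) \<in> borel_measurable ?H \<longleftrightarrow>
        (\<lambda>s. closest_point \<X> (X t s - (1 / (2 * \<alpha>)) *\<^sub>R weighted_subgradient t s)) \<in> borel_measurable ?H"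
      by (rule measurable_cong)
        (use proximal_step_eq_closest_point[OF convex_X closed_X \<alpha>_pos X_step] in simp)
    ultimately have X_Suc [measurable]: "X (Suc t) \<in> borel_measurable ?H"
      by simp
    have "Q i (Suc (Suc t)) \<in> borel_measurable ?H" if i: "i \<in> {1..k}" for i
    proof -
      have "(\<lambda>s. ghat i (X t s) (\<omega> t s)) \<in> borel_measurable ?H"
        by (rule random_cost_measurable[OF random_cost_g[OF i]]) (simp_all add: X_in)
      then have "(\<lambda>s. max (Q i (Suc t) s + ghat i (X t s) (\<omega> t s)
          + gsub t i (X t s) (\<omega> t s) \<bullet> (X (Suc t) s - X t s)) 0) \<in> borel_measurable ?H"
        using Q_t[OF i] gsub_t[OF i]
        by (intro borel_measurable_max borel_measurable_add borel_measurable_inner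
            borel_measurable_diff borel_measurable_const) simp_all
      moreover have "Q i (Suc (Suc t)) \<in> borel_measurable ?H \<longleftrightarrow>
          (\<lambda>s. max (Q i (Suc t) s + ghat i (X t s) (\<omega> t s)
            + gsub t i (X t s) (\<omega> t s) \<bullet> (X (Suc t) s - X t s)) 0) \<in> borel_measurable ?H"
        by (rule measurable_cong) (use Q_step[OF _ i] in simp)
      ultimately show ?thesis by simp
    qed
    then show ?case using X_Suc by blast
  qed
  then show "X t \<in> borel_measurable (history M \<omega> t)"
    and "i \<in> {1..k} \<Longrightarrow> Q i (Suc t) \<in> borel_measurable (history M \<omega> t)"
    by auto
qed

lemma X_valid: "valid_decision_seq M \<omega> \<X> X"
  unfolding valid_decision_seq_def
  using X_in indep_rv_history[OF indep_omega X_measurable_history] by blast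

lemma X_measurable [measurable]: "X t \<in> borel_measurable M"
  using X_valid by (auto simp: valid_decision_seq_def indep_rv_def)

lemma Q_indep: "i \<in> {1..k} \<Longrightarrow> indep_rv M (Q i (Suc t)) (\<omega> t)"
  by (rule indep_rv_history[OF indep_omega Q_measurable_history])

lemma Q_measurable: "i \<in> {1..k} \<Longrightarrow> Q i (Suc t) \<in> borel_measurable M"
  using Q_indep by (auto simp: indep_rv_def)

lemma Q_integrable:
  assumes "i \<in> {1..k}"
  shows "integrable M (Q i (Suc t))" "integrable M (\<lambda>s. (Q i (Suc t) s)\<^sup>2)"
proof -
  have bound: "\<bar>Q i (Suc t) s\<bar> \<le> real t * (F + G * D)" if "s \<in> space M" for s
    using Q_nonneg[OF that assms, of t] Q_le[OF that assms, of t] by simp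
  show "integrable M (Q i (Suc t))"
    by (rule integrable_bounded[OF Q_measurable[OF assms] bound])
  show "integrable M (\<lambda>s. (Q i (Suc t) s)\<^sup>2)"
  proof (rule integrable_bounded[where B = "(real t * (F + G * D))\<^sup>2"])
    show "(\<lambda>s. (Q i (Suc t) s)\<^sup>2) \<in> borel_measurable M"
      using Q_measurable[OF assms, of t] by simp
    show "\<bar>(Q i (Suc t) s)\<^sup>2\<bar> \<le> (real t * (F + G * D))\<^sup>2" if "s \<in> space M" for s
      using power_mono[OF bound[OF that], of 2] by simp
  qed
qed

lemma displacement_integrable:
  "integrable M (\<lambda>s. norm (X (Suc t) s - X t s))"
  "integrable M (\<lambda>s. (norm (X (Suc t) s - X t s))\<^sup>2)"
proof -
  have bound: "norm (X (Suc t) s - X t s) \<le> D" if "s \<in> space M" for s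
    using diameter_X X_in that by blast
  show "integrable M (\<lambda>s. norm (X (Suc t) s - X t s))"
    by (rule integrable_bounded[of _ D]) (simp_all add: bound)
  show "integrable M (\<lambda>s. (norm (X (Suc t) s - X t s))\<^sup>2)"
    by (rule integrable_bounded[of _ "D\<^sup>2"]) (simp_all add: bound power_mono)
qed

text \<open>
  The loss of a single slot: the squared queue increments, and the price of moving away from \<open>X t\<close>, where
  the gradient of \<open>f\<^sub>t\<close> is evaluated.
\<close>

definition slot_error :: real where
  "slot_error = real k * (F + G * D)\<^sup>2 / 2 + V\<^sup>2 * G\<^sup>2 / (2 * \<alpha>)"

text \<open>
  Bounding the increment of the squared queues by its linear part yields, together with the linearised
  penalty, the function that the algorithm minimises; the competitor \<open>x\<close> then enters through the proximal inequality, and the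
  subgradient inequalities convert the linearisations at \<open>X t\<close> into values at \<open>x\<close>. Young's
  inequality for the step from \<open>X t\<close> to \<open>X (Suc t)\<close> uses only half of the proximal term, and the other
  half is kept on the left to control the displacements.
\<close>

lemma drift_plus_penalty_step:
  assumes s: "s \<in> space M" and x: "x \<in> \<X>"
  shows "(\<Sum>i=1..k. (Q i (Suc (Suc t)) s)\<^sup>2 / 2) - (\<Sum>i=1..k. (Q i (Suc t) s)\<^sup>2 / 2)
      + \<alpha> / 2 * (norm (X (Suc t) s - X t s))\<^sup>2 + V * fhat (X t s) (\<omega> t s)
    \<le> slot_error + V * fhat x (\<omega> t s) + (\<Sum>i=1..k. Q i (Suc t) s * ghat i x (\<omega> t s))
      + \<alpha> * (norm (x - X t s))\<^sup>2 - \<alpha> * (norm (x - X (Suc t) s))\<^sup>2"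
proof -
  define a b w where "a = X t s" and "b = X (Suc t) s" and "w = \<omega> t s"
  define q where "q i = Q i (Suc t) s" for i
  define u where "u = fsub t a w"
  define v where "v i = gsub t i a w" for i
  define y where "y i = ghat i a w + v i \<bullet> (b - a)" for i
  have ab: "a \<in> \<X>" "b \<in> \<X>" using X_in[OF s] by (auto simp: a_def b_def)
  have queue: "(Q i (Suc (Suc t)) s)\<^sup>2 / 2 - (q i)\<^sup>2 / 2 \<le> q i * y i + (F + G * D)\<^sup>2 / 2"
    if i: "i \<in> {1..k}" for i
  proof -
    have "\<bar>y i\<bar> \<le> F + G * D"
      using linearized_constraint_bounded[OF s i, of t] by (simp add: y_def v_def a_def b_def w_def)
    from power_mono[OF this, of 2] have y: "(y i)\<^sup>2 \<le> (F + G * D)\<^sup>2" by simp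
    have "Q i (Suc (Suc t)) s = max (q i + y i) 0"
      using Q_step[OF s i, of t] by (simp add: q_def y_def v_def a_def b_def w_def add.assoc)
    then have "(Q i (Suc (Suc t)) s)\<^sup>2 \<le> (q i + y i)\<^sup>2"
      by (simp add: max_def)
    then show ?thesis using y by (simp add: power2_sum field_simps)
  qed
  have "(\<Sum>i=1..k. (Q i (Suc (Suc t)) s)\<^sup>2 / 2) - (\<Sum>i=1..k. (q i)\<^sup>2 / 2)
      \<le> (\<Sum>i=1..k. q i * y i + (F + G * D)\<^sup>2 / 2)"
    unfolding sum_subtractf[symmetric] by (rule sum_mono) (rule queue)
  also have "\<dots> = (\<Sum>i=1..k. q i * y i) + real k * (F + G * D)\<^sup>2 / 2"
    by (simp add: sum.distrib)
  finally have drift: "(\<Sum>i=1..k. (Q i (Suc (Suc t)) s)\<^sup>2 / 2) - (\<Sum>i=1..k. (q i)\<^sup>2 / 2)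
      \<le> (\<Sum>i=1..k. q i * y i) + real k * (F + G * D)\<^sup>2 / 2" .
  have dir: "weighted_subgradient t s \<bullet> z = V * (u \<bullet> z) + (\<Sum>i=1..k. q i * (v i \<bullet> z))" for z
    by (simp add: weighted_subgradient_def u_def v_def q_def a_def w_def inner_add_left inner_sum_left)
  have prox: "weighted_subgradient t s \<bullet> b + \<alpha> * (norm (b - a))\<^sup>2 + \<alpha> * (norm (x - b))\<^sup>2
      \<le> weighted_subgradient t s \<bullet> x + \<alpha> * (norm (x - a))\<^sup>2"
    using proximal_step_inequality[OF convex_X closed_X \<alpha>_pos X_step[OF s] x, of t]
    by (simp add: a_def b_def)
  have young: "- (V * (u \<bullet> (b - a))) \<le> V\<^sup>2 * G\<^sup>2 / (2 * \<alpha>) + \<alpha> / 2 * (norm (b - a))\<^sup>2"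
  proof -
    have "- (V * (u \<bullet> (b - a))) \<le> V * (norm u * norm (b - a))"
      using Cauchy_Schwarz_ineq2[of u "b - a"] mult_left_mono[of "- (u \<bullet> (b - a))" "norm u * norm (b - a)" V] V_pos
      by simp
    also have "\<dots> \<le> V * (G * norm (b - a))"
      using fsub_bounded[OF s ab(1), of t] V_pos
      by (intro mult_left_mono mult_right_mono) (auto simp: u_def w_def)
    also have "\<dots> \<le> V\<^sup>2 * G\<^sup>2 / (2 * \<alpha>) + \<alpha> / 2 * (norm (b - a))\<^sup>2"
    proof -
      have "0 \<le> (V * G - \<alpha> * norm (b - a))\<^sup>2 / (2 * \<alpha>)"
        using \<alpha>_pos by simp
      then show ?thesis
        using \<alpha>_pos by (simp add: power2_diff power_mult_distrib field_simps power2_eq_square)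
    qed
    finally show ?thesis .
  qed
  have f_sub: "V * (u \<bullet> (x - a)) \<le> V * (fhat x w - fhat a w)"
    using f_subgradient[OF s ab(1) x, of t] V_pos by (intro mult_left_mono) (simp_all add: u_def w_def)
  have g_sub: "(\<Sum>i=1..k. q i * (ghat i a w + v i \<bullet> (x - a))) \<le> (\<Sum>i=1..k. q i * ghat i x w)"
    using g_subgradient[OF _ s ab(1) x, of _ t] Q_nonneg[OF s]
    by (intro sum_mono mult_left_mono) (simp_all add: v_def w_def q_def)
  have "(\<Sum>i=1..k. q i * y i) = (\<Sum>i=1..k. q i * ghat i a w) + (\<Sum>i=1..k. q i * (v i \<bullet> b)) - (\<Sum>i=1..k. q i * (v i \<bullet> a))"
    "(\<Sum>i=1..k. q i * (ghat i a w + v i \<bullet> (x - a)))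
      = (\<Sum>i=1..k. q i * ghat i a w) + (\<Sum>i=1..k. q i * (v i \<bullet> x)) - (\<Sum>i=1..k. q i * (v i \<bullet> a))"
    by (simp_all add: y_def inner_diff_right sum.distrib sum_subtractf algebra_simps)
  then show ?thesis
    using drift prox young f_sub g_sub
    unfolding dir slot_error_def a_def[symmetric] b_def[symmetric] w_def[symmetric] q_def[symmetric]
    by (simp add: inner_diff_right algebra_simps)
qed

lemma drift_plus_penalty:
  assumes s: "s \<in> space M" and x: "x \<in> \<X>"
  shows "(\<Sum>i=1..k. (Q i (Suc T) s)\<^sup>2 / 2) + \<alpha> / 2 * (\<Sum>t<T. (norm (X (Suc t) s - X t s))\<^sup>2)
      + V * (\<Sum>t<T. fhat (X t s) (\<omega> t s))
    \<le> real T * slot_error + \<alpha> * D\<^sup>2 + V * (\<Sum>t<T. fhat x (\<omega> t s))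
      + (\<Sum>i=1..k. \<Sum>t<T. Q i (Suc t) s * ghat i x (\<omega> t s))"
proof -
  have "(\<Sum>i=1..k. (Q i (Suc T) s)\<^sup>2 / 2) + \<alpha> / 2 * (\<Sum>t<T. (norm (X (Suc t) s - X t s))\<^sup>2)
      + V * (\<Sum>t<T. fhat (X t s) (\<omega> t s))
    \<le> real T * slot_error + \<alpha> * (norm (x - X 0 s))\<^sup>2 - \<alpha> * (norm (x - X T s))\<^sup>2
      + V * (\<Sum>t<T. fhat x (\<omega> t s)) + (\<Sum>i=1..k. \<Sum>t<T. Q i (Suc t) s * ghat i x (\<omega> t s))"
  proof (induction T)
    case 0
    show ?case by (simp add: Q_1[OF s])
  next
    case (Suc T)
    then show ?case
      using drift_plus_penalty_step[OF s x, of T] by (simp add: sum.distrib algebra_simps)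
  qed
  moreover have "\<alpha> * (norm (x - X 0 s))\<^sup>2 \<le> \<alpha> * D\<^sup>2"
    using \<alpha>_pos diameter_X[OF x X_in[OF s]] by (intro mult_left_mono power_mono) auto
  moreover have "0 \<le> \<alpha> * (norm (x - X T s))\<^sup>2"
    using \<alpha>_pos by simp
  ultimately show ?thesis by linarith
qed

text \<open>
  The queue recursion without the maximum with 0 is a lower bound for the new queue, so the sum of the
  linearised constraint values telescopes.
\<close>

lemma cumulative_constraint_le:
  assumes s: "s \<in> space M" and i: "i \<in> {1..k}"
  shows "(\<Sum>t<T. ghat i (X t s) (\<omega> t s)) \<le> Q i (Suc T) s + G * (\<Sum>t<T. norm (X (Suc t) s - X t s))"
proof (induction T)
  case 0
  show ?case by (simp add: Q_1[OF s i])
next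
  case (Suc T)
  have "- (gsub T i (X T s) (\<omega> T s) \<bullet> (X (Suc T) s - X T s))
      \<le> norm (gsub T i (X T s) (\<omega> T s)) * norm (X (Suc T) s - X T s)"
    using Cauchy_Schwarz_ineq2[of "gsub T i (X T s) (\<omega> T s)" "X (Suc T) s - X T s"] by simp
  also have "\<dots> \<le> G * norm (X (Suc T) s - X T s)"
    by (intro mult_right_mono gsub_bounded[OF i s X_in[OF s]]) simp
  finally show ?case
    using Suc Q_step[OF s i, of T] by (simp add: distrib_left)
qed

abbreviation mean_queue :: "nat \<Rightarrow> nat \<Rightarrow> real" where
  "mean_queue i t \<equiv> expectation (Q i t)"

abbreviation mean_queue_sq :: "nat \<Rightarrow> nat \<Rightarrow> real" where
  "mean_queue_sq i t \<equiv> expectation (\<lambda>s. (Q i t s)\<^sup>2)"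

abbreviation mean_step :: "nat \<Rightarrow> real" where
  "mean_step t \<equiv> expectation (\<lambda>s. norm (X (Suc t) s - X t s))"

abbreviation mean_step_sq :: "nat \<Rightarrow> real" where
  "mean_step_sq t \<equiv> expectation (\<lambda>s. (norm (X (Suc t) s - X t s))\<^sup>2)"

text \<open>
  The queue \<open>Q i (Suc t)\<close> is independent of \<open>\<omega> t\<close>, which splits the expectation of the products with
  \<open>ghat i x (\<omega> t s)\<close>.
\<close>

lemma expected_drift_plus_penalty:
  assumes x: "x \<in> \<X>"
  shows "(\<Sum>i=1..k. mean_queue_sq i (Suc T) / 2) + \<alpha> / 2 * (\<Sum>t<T. mean_step_sq t)
      + V * (\<Sum>t<T. expected_value M \<omega> fhat X t)
    \<le> real T * slot_error + \<alpha> * D\<^sup>2 + V * (real T * mean_cost fhat x)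
      + (\<Sum>i=1..k. (\<Sum>t<T. mean_queue i (Suc t)) * mean_cost (ghat i) x)"
proof -
  have f: "integrable M (\<lambda>s. fhat (X t s) (\<omega> t s))" "integrable M (\<lambda>s. fhat x (\<omega> t s))" for t
    using integrable_random_cost[OF random_cost_f X_measurable X_in]
      integrable_random_cost[OF random_cost_f borel_measurable_const x] by auto
  have g: "integrable M (\<lambda>s. ghat i x (\<omega> t s))" if "i \<in> {1..k}" for i t
    using integrable_random_cost[OF random_cost_g[OF that] borel_measurable_const x] .
  have Qg: "integrable M (\<lambda>s. Q i (Suc t) s * ghat i x (\<omega> t s))" if i: "i \<in> {1..k}" for i t
  proof (rule integrable_bounded[where B = "real t * (F + G * D) * F"])
    show "(\<lambda>s. Q i (Suc t) s * ghat i x (\<omega> t s)) \<in> borel_measurable M"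
      using Q_measurable[OF i] g[OF i] by (intro borel_measurable_times) auto
    fix s assume s: "s \<in> space M"
    show "\<bar>Q i (Suc t) s * ghat i x (\<omega> t s)\<bar> \<le> real t * (F + G * D) * F"
      unfolding abs_mult using Q_nonneg[OF s i, of t] Q_le[OF s i, of t] g_bounded[OF i s x, of t]
      by (intro mult_mono) auto
  qed
  have Qg_mean: "expectation (\<lambda>s. Q i (Suc t) s * ghat i x (\<omega> t s))
      = mean_queue i (Suc t) * mean_cost (ghat i) x" if i: "i \<in> {1..k}" for i t
    using expectation_indep_rv_mult[OF Q_indep[OF i] g_measurable[OF i x] Q_integrable(1)[OF i] g[OF i]]
    by (simp add: expectation_random_cost[OF random_cost_g[OF i] x])
  have int: "integrable M (\<lambda>s. \<Sum>i=1..k. (Q i (Suc T) s)\<^sup>2 / 2)"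
    "integrable M (\<lambda>s. \<alpha> / 2 * (\<Sum>t<T. (norm (X (Suc t) s - X t s))\<^sup>2))"
    "integrable M (\<lambda>s. V * (\<Sum>t<T. fhat (X t s) (\<omega> t s)))"
    "integrable M (\<lambda>s. V * (\<Sum>t<T. fhat x (\<omega> t s)))"
    "integrable M (\<lambda>s. \<Sum>i=1..k. \<Sum>t<T. Q i (Suc t) s * ghat i x (\<omega> t s))"
    by (intro Bochner_Integration.integrable_sum integrable_mult_right integrable_divide_zero
        Q_integrable displacement_integrable f Qg; assumption)+
  have "expectation (\<lambda>s. (\<Sum>i=1..k. (Q i (Suc T) s)\<^sup>2 / 2)
        + \<alpha> / 2 * (\<Sum>t<T. (norm (X (Suc t) s - X t s))\<^sup>2) + V * (\<Sum>t<T. fhat (X t s) (\<omega> t s)))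
    \<le> expectation (\<lambda>s. real T * slot_error + \<alpha> * D\<^sup>2 + V * (\<Sum>t<T. fhat x (\<omega> t s))
      + (\<Sum>i=1..k. \<Sum>t<T. Q i (Suc t) s * ghat i x (\<omega> t s)))"
    by (rule integral_mono[OF _ _ drift_plus_penalty[OF _ x]])
      (intro Bochner_Integration.integrable_add int integrable_const; assumption)+
  also have "expectation (\<lambda>s. (\<Sum>i=1..k. (Q i (Suc T) s)\<^sup>2 / 2)
        + \<alpha> / 2 * (\<Sum>t<T. (norm (X (Suc t) s - X t s))\<^sup>2) + V * (\<Sum>t<T. fhat (X t s) (\<omega> t s)))
    = (\<Sum>i=1..k. mean_queue_sq i (Suc T) / 2) + \<alpha> / 2 * (\<Sum>t<T. mean_step_sq t)
      + V * (\<Sum>t<T. expected_value M \<omega> fhat X t)"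
    by (simp only: Bochner_Integration.integral_add Bochner_Integration.integrable_add int
        integral_mult_right_zero integral_divide_zero Bochner_Integration.integral_sum
        Q_integrable displacement_integrable f expected_value_def integrable_divide_zero)
  also have "expectation (\<lambda>s. real T * slot_error + \<alpha> * D\<^sup>2 + V * (\<Sum>t<T. fhat x (\<omega> t s))
      + (\<Sum>i=1..k. \<Sum>t<T. Q i (Suc t) s * ghat i x (\<omega> t s)))
    = real T * slot_error + \<alpha> * D\<^sup>2 + V * (real T * mean_cost fhat x)
      + (\<Sum>i=1..k. (\<Sum>t<T. mean_queue i (Suc t)) * mean_cost (ghat i) x)"
    by (simp add: Bochner_Integration.integral_add Bochner_Integration.integrable_add int f Qg Qg_mean
        expectation_random_cost[OF random_cost_f x] prob_space sum_distrib_right del: One_nat_def)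
  finally show ?thesis .
qed

lemma expected_cumulative_constraint_le:
  assumes i: "i \<in> {1..k}"
  shows "(\<Sum>t<T. expected_value M \<omega> (ghat i) X t)
    \<le> mean_queue i (Suc T) + G * (\<Sum>t<T. mean_step t)"
proof -
  have g: "integrable M (\<lambda>s. ghat i (X t s) (\<omega> t s))" for t
    by (rule integrable_random_cost[OF random_cost_g[OF i]]) (simp_all add: X_in)
  have "expectation (\<lambda>s. \<Sum>t<T. ghat i (X t s) (\<omega> t s))
    \<le> expectation (\<lambda>s. Q i (Suc T) s + G * (\<Sum>t<T. norm (X (Suc t) s - X t s)))"
    using g Q_integrable(1)[OF i] displacement_integrable(1)
    by (intro integral_mono cumulative_constraint_le i) auto
  then show ?thesis
    using g Q_integrable(1)[OF i] displacement_integrable(1) by (simp add: expected_value_def)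
qed

lemma drift_le_optimal_value:
  assumes T: "T \<ge> 1"
  shows "ereal (((\<Sum>i=1..k. mean_queue_sq i (Suc T) / 2) + \<alpha> / 2 * (\<Sum>t<T. mean_step_sq t)
      + V * (\<Sum>t<T. expected_value M \<omega> fhat X t) - real T * slot_error - \<alpha> * D\<^sup>2) / (V * real T))
    \<le> optimal_value M \<omega> \<X> k fhat ghat"
proof (rule optimal_value_lower_bound)
  show "0 < V * real T" using V_pos T by simp
  show "0 \<le> (\<Sum>t<T. mean_queue i (Suc t))" if "i \<in> {1..k}" for i
    by (intro sum_nonneg Bochner_Integration.integral_nonneg_AE AE_I2 Q_nonneg that)
  show "(\<Sum>i=1..k. mean_queue_sq i (Suc T) / 2) + \<alpha> / 2 * (\<Sum>t<T. mean_step_sq t)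
      + V * (\<Sum>t<T. expected_value M \<omega> fhat X t) - real T * slot_error - \<alpha> * D\<^sup>2
    \<le> V * real T * mean_cost fhat x + (\<Sum>i=1..k. (\<Sum>t<T. mean_queue i (Suc t)) * mean_cost (ghat i) x)"
    if "x \<in> \<X>" for x
    using expected_drift_plus_penalty[OF that, of T] by (simp add: mult.assoc)
qed

text \<open>
  The queues and the displacements contribute nonnegative terms, which may be dropped.
\<close>

lemma objective_bound:
  assumes T: "T \<ge> 1"
  shows "ereal (time_average (expected_value M \<omega> fhat X) T)
    \<le> optimal_value M \<omega> \<X> k fhat ghat + ereal (slot_error / V + \<alpha> * D\<^sup>2 / (V * real T))"
proof -
  let ?f = "\<Sum>t<T. expected_value M \<omega> fhat X t"
  have VT: "V * real T > 0" using V_pos T by simp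
  have "0 \<le> (\<Sum>i=1..k. mean_queue_sq i (Suc T) / 2)"
    by (intro sum_nonneg divide_nonneg_pos Bochner_Integration.integral_nonneg) auto
  moreover have "0 \<le> \<alpha> / 2 * (\<Sum>t<T. mean_step_sq t)"
    using \<alpha>_pos by (intro mult_nonneg_nonneg sum_nonneg Bochner_Integration.integral_nonneg) auto
  ultimately have "(V * ?f - real T * slot_error - \<alpha> * D\<^sup>2) / (V * real T)
      \<le> ((\<Sum>i=1..k. mean_queue_sq i (Suc T) / 2) + \<alpha> / 2 * (\<Sum>t<T. mean_step_sq t)
          + V * ?f - real T * slot_error - \<alpha> * D\<^sup>2) / (V * real T)"
    using VT by (intro divide_right_mono) simp_all
  then have "ereal ((V * ?f - real T * slot_error - \<alpha> * D\<^sup>2) / (V * real T))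
      \<le> optimal_value M \<omega> \<X> k fhat ghat"
    by (intro order_trans[OF _ drift_le_optimal_value[OF T]]) (simp only: ereal_less_eq)
  also have "(V * ?f - real T * slot_error - \<alpha> * D\<^sup>2) / (V * real T)
      = time_average (expected_value M \<omega> fhat X) T - (slot_error / V + \<alpha> * D\<^sup>2 / (V * real T))"
    using V_pos T by (simp add: time_average_def field_simps)
  finally show ?thesis
    by (cases "optimal_value M \<omega> \<X> k fhat ghat") (auto simp: algebra_simps)
qed

text \<open>
  The multiplier inequality for the decisions of the algorithm bounds \<open>f\<^sup>*\<close> minus their expected
  objective by the weighted constraint values, that is, linearly by queues and displacements. The quadratic
  terms of the drift bound have coefficients \<open>1/2\<close> and \<open>\<alpha>/2\<close>; Young's inequality with \<open>1/4\<close> and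
  \<open>\<alpha>/4\<close> absorbs the linear terms and leaves half of them.
\<close>

lemma energy_bound:
  assumes \<mu>: "lagrange_multipliers M \<omega> \<X> k fhat ghat \<mu>" and T: "T \<ge> 1"
  shows "(\<Sum>i=1..k. mean_queue_sq i (Suc T)) + \<alpha> * (\<Sum>t<T. mean_step_sq t)
    \<le> 4 * (real T * slot_error + \<alpha> * D\<^sup>2 + V\<^sup>2 * (\<Sum>i=1..k. (\<mu> i)\<^sup>2)
        + real T * (V\<^sup>2 * (\<Sum>i=1..k. \<mu> i)\<^sup>2 * G\<^sup>2 / \<alpha>))"
proof -
  let ?f = "\<lambda>t. expected_value M \<omega> fhat X t" and ?g = "\<lambda>i t. expected_value M \<omega> (ghat i) X t"
  define m where "m = (\<Sum>i=1..k. \<mu> i)"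
  have \<mu>_nonneg: "\<mu> i \<ge> 0" if "i \<in> {1..k}" for i
    using \<mu> that by (auto simp: lagrange_multipliers_def)
  have lagrange: "optimal_value M \<omega> \<X> k fhat ghat \<le> ereal (?f t + (\<Sum>i=1..k. \<mu> i * ?g i t))" for t
    using \<mu> X_valid unfolding lagrange_multipliers_def by blast
  \<comment> \<open>The optimal value is finite: it is bounded above by the multiplier inequality and below by the
    drift bound.\<close>
  have "optimal_value M \<omega> \<X> k fhat ghat \<noteq> \<infinity>" "optimal_value M \<omega> \<X> k fhat ghat \<noteq> -\<infinity>"
    using lagrange[of 0] drift_le_optimal_value[OF T] by auto
  then obtain p where p: "optimal_value M \<omega> \<X> k fhat ghat = ereal p"
    by (cases "optimal_value M \<omega> \<X> k fhat ghat") auto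
  have "real T * p = (\<Sum>t<T. p)" by simp
  also have "\<dots> \<le> (\<Sum>t<T. ?f t + (\<Sum>i=1..k. \<mu> i * ?g i t))"
    using lagrange by (intro sum_mono) (simp add: p)
  also have "\<dots> = (\<Sum>t<T. ?f t) + (\<Sum>i=1..k. \<mu> i * (\<Sum>t<T. ?g i t))"
    by (simp add: sum.distrib sum_distrib_left) (rule sum.swap)
  also have "(\<Sum>i=1..k. \<mu> i * (\<Sum>t<T. ?g i t))
      \<le> (\<Sum>i=1..k. \<mu> i * (mean_queue i (Suc T) + G * (\<Sum>t<T. mean_step t)))"
    by (intro sum_mono mult_left_mono expected_cumulative_constraint_le \<mu>_nonneg)
  finally have "V * (real T * p) \<le> V * ((\<Sum>t<T. ?f t)
      + (\<Sum>i=1..k. \<mu> i * (mean_queue i (Suc T) + G * (\<Sum>t<T. mean_step t))))"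
    using V_pos by (intro mult_left_mono) auto
  also have "\<dots> = V * (\<Sum>t<T. ?f t) + (\<Sum>i=1..k. V * \<mu> i * mean_queue i (Suc T))
      + (\<Sum>t<T. V * m * G * mean_step t)"
  proof -
    have "(\<Sum>i=1..k. \<mu> i * (mean_queue i (Suc T) + G * (\<Sum>t<T. mean_step t)))
        = (\<Sum>i=1..k. \<mu> i * mean_queue i (Suc T)) + m * (G * (\<Sum>t<T. mean_step t))"
      unfolding m_def sum_distrib_right sum.distrib[symmetric] by (simp add: distrib_left)
    then show ?thesis
      by (simp add: distrib_left sum_distrib_left mult.assoc)
  qed
  also have "(\<Sum>i=1..k. V * \<mu> i * mean_queue i (Suc T))
      \<le> (\<Sum>i=1..k. mean_queue_sq i (Suc T) / 4 + V\<^sup>2 * (\<mu> i)\<^sup>2)"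
  proof (rule sum_mono)
    fix i assume "i \<in> {1..k}"
    then show "V * \<mu> i * mean_queue i (Suc T) \<le> mean_queue_sq i (Suc T) / 4 + V\<^sup>2 * (\<mu> i)\<^sup>2"
      using expectation_young[OF Q_integrable, of i "1 / 4" "V * \<mu> i" T]
      by (simp add: power_mult_distrib)
  qed
  also have "(\<Sum>t<T. V * m * G * mean_step t)
      \<le> (\<Sum>t<T. \<alpha> / 4 * mean_step_sq t + V\<^sup>2 * m\<^sup>2 * G\<^sup>2 / \<alpha>)"
    using expectation_young[OF displacement_integrable, of "\<alpha> / 4" "V * m * G"] \<alpha>_pos
    by (intro sum_mono) (auto simp: power_mult_distrib)
  finally have upper: "V * (real T * p) \<le> V * (\<Sum>t<T. ?f t)
      + (\<Sum>i=1..k. mean_queue_sq i (Suc T)) / 4 + V\<^sup>2 * (\<Sum>i=1..k. (\<mu> i)\<^sup>2)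
      + \<alpha> / 4 * (\<Sum>t<T. mean_step_sq t) + real T * (V\<^sup>2 * m\<^sup>2 * G\<^sup>2 / \<alpha>)"
    by (simp add: sum.distrib sum_distrib_left sum_divide_distrib)
  have "V * real T > 0" using V_pos T by simp
  then have "(\<Sum>i=1..k. mean_queue_sq i (Suc T) / 2) + \<alpha> / 2 * (\<Sum>t<T. mean_step_sq t)
      + V * (\<Sum>t<T. ?f t) - real T * slot_error - \<alpha> * D\<^sup>2 \<le> V * (real T * p)"
    using drift_le_optimal_value[OF T] unfolding p ereal_less_eq(3)
    by (simp only: pos_divide_le_eq) (simp add: mult_ac)
  then show ?thesis
    using upper by (simp add: m_def sum_divide_distrib[symmetric])
qed

text \<open>
  Young's inequality with a free weight \<open>\<delta>\<close> turns the bound \<open>E\<close> on the second moments into bounds on the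
  first moments that appear in \<open>expected_cumulative_constraint_le\<close>.
\<close>

lemma constraint_bound:
  assumes \<mu>: "lagrange_multipliers M \<omega> \<X> k fhat ghat \<mu>" and T: "T \<ge> 1" and i: "i \<in> {1..k}"
    and \<delta>: "\<delta> > 0"
    and E: "(\<Sum>i=1..k. mean_queue_sq i (Suc T)) + \<alpha> * (\<Sum>t<T. mean_step_sq t) \<le> E"
  shows "(\<Sum>t<T. expected_value M \<omega> (ghat i) X t)
    \<le> \<delta> / 2 * E + 1 / (2 * \<delta>) + G * (E / (2 * \<alpha> * \<delta>) + real T * \<delta> / 2)"
proof -
  have step_nonneg: "0 \<le> (\<Sum>t<T. mean_step_sq t)"
    by (intro sum_nonneg Bochner_Integration.integral_nonneg) simp
  have "mean_queue_sq i (Suc T) \<le> (\<Sum>i=1..k. mean_queue_sq i (Suc T))"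
    by (rule member_le_sum[OF i]) (auto intro: Bochner_Integration.integral_nonneg)
  also have "\<dots> \<le> E"
    using E mult_nonneg_nonneg[OF less_imp_le[OF \<alpha>_pos] step_nonneg] by linarith
  finally have "\<delta> / 2 * mean_queue_sq i (Suc T) \<le> \<delta> / 2 * E"
    using \<delta> by (intro mult_left_mono) auto
  moreover have "mean_queue i (Suc T) \<le> \<delta> / 2 * mean_queue_sq i (Suc T) + 1 / (2 * \<delta>)"
    using expectation_young[OF Q_integrable[OF i], of "\<delta> / 2" 1 T] \<delta> by simp
  ultimately have queue: "mean_queue i (Suc T) \<le> \<delta> / 2 * E + 1 / (2 * \<delta>)"
    by linarith
  have "(\<Sum>t<T. mean_step t) \<le> (\<Sum>t<T. 1 / (2 * \<delta>) * mean_step_sq t + \<delta> / 2)"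
    using expectation_young[OF displacement_integrable, of "1 / (2 * \<delta>)" 1] \<delta>
    by (intro sum_mono) auto
  also have "\<dots> = 1 / (2 * \<delta>) * (\<Sum>t<T. mean_step_sq t) + real T * \<delta> / 2"
    by (simp add: sum.distrib sum_distrib_left)
  also have "\<dots> \<le> 1 / (2 * \<delta>) * (E / \<alpha>) + real T * \<delta> / 2"
  proof -
    have "0 \<le> (\<Sum>i=1..k. mean_queue_sq i (Suc T))"
      by (intro sum_nonneg Bochner_Integration.integral_nonneg) simp
    then have "(\<Sum>t<T. mean_step_sq t) \<le> E / \<alpha>"
      using E \<alpha>_pos by (simp add: pos_le_divide_eq mult.commute)
    then show ?thesis using \<delta> by (intro add_mono mult_left_mono) auto
  qed
  finally have "G * (\<Sum>t<T. mean_step t) \<le> G * (E / (2 * \<alpha> * \<delta>) + real T * \<delta> / 2)"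
    using G_pos by (intro mult_left_mono) (simp_all add: mult_ac)
  then show ?thesis
    using queue expected_cumulative_constraint_le[OF i, of T] by linarith
qed

end

section \<open>Performance of the algorithm\<close>

theorem theorem6:
  fixes M :: "'s measure"
    and \<omega> :: "nat \<Rightarrow> 's \<Rightarrow> 'w::euclidean_space"
    and \<X> :: "(real ^ 'n) set"
    and k :: nat
    and fhat :: "real ^ 'n \<Rightarrow> 'w \<Rightarrow> real"
    and ghat :: "nat \<Rightarrow> real ^ 'n \<Rightarrow> 'w \<Rightarrow> real"
    and fsub :: "nat \<Rightarrow> real ^ 'n \<Rightarrow> 'w \<Rightarrow> real ^ 'n"
    and gsub :: "nat \<Rightarrow> nat \<Rightarrow> real ^ 'n \<Rightarrow> 'w \<Rightarrow> real ^ 'n"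
    and D F G :: real
    and \<mu> :: "nat \<Rightarrow> real"
    and x0 :: "real ^ 'n"
  assumes model: "model2 M \<omega> \<X> k fhat ghat fsub gsub D F G"
    and feasible: "\<exists>X. feasible_seq M \<omega> \<X> k ghat X"
    and multipliers: "lagrange_multipliers M \<omega> \<X> k fhat ghat \<mu>"
    and x0: "x0 \<in> \<X>"
  shows "\<exists>c::real. \<forall>\<epsilon>>0. \<forall>X Q.
           algorithm_run M \<omega> \<X> k ghat fsub gsub x0 (1 / \<epsilon>) (1 / \<epsilon>\<^sup>2) X Q \<longrightarrow>
           (\<forall>T::nat. real T \<ge> 1 / \<epsilon>\<^sup>2 \<longrightarrow>
              ereal (time_average (expected_value M \<omega> fhat X) T)
                \<le> optimal_value M \<omega> \<X> k fhat ghat + ereal (c * \<epsilon>) \<and>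
              (\<forall>i\<in>{1..k}. time_average (expected_value M \<omega> (ghat i) X) T \<le> c * \<epsilon>))"
proof -
  interpret model2 M \<omega> \<X> k fhat ghat fsub gsub D F G by (rule model)
  \<comment> \<open>\<open>c0\<close> collects \<open>slot_error\<close> at \<open>V\<^sup>2 = \<alpha>\<close> and the initial distance; \<open>4 T c1\<close> is the
    resulting value of the energy bound.\<close>
  define c0 where "c0 = real k * (F + G * D)\<^sup>2 / 2 + G\<^sup>2 / 2 + D\<^sup>2"
  define c1 where "c1 = c0 + (\<Sum>i=1..k. (\<mu> i)\<^sup>2) + (\<Sum>i=1..k. \<mu> i)\<^sup>2 * G\<^sup>2"
  define c where "c = c0 + (1 + G) * (2 * c1 + 1 / 2)"
  have c0: "c0 \<ge> 0" by (simp add: c0_def)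
  have c1: "c1 \<ge> 0" using c0 by (simp add: c1_def sum_nonneg)
  have le_c: "c0 \<le> c" "(1 + G) * (2 * c1 + 1 / 2) \<le> c"
    using c0 c1 G_pos by (simp_all add: c_def)
  show ?thesis
  proof (intro exI[of _ c] allI impI conjI ballI)
    fix \<epsilon> :: real and X Q and T :: nat
    assume \<epsilon>: "0 < \<epsilon>" and T: "1 / \<epsilon>\<^sup>2 \<le> real T"
      and run: "algorithm_run M \<omega> \<X> k ghat fsub gsub x0 (1 / \<epsilon>) (1 / \<epsilon>\<^sup>2) X Q"
    interpret online_run M \<omega> \<X> k fhat ghat fsub gsub D F G x0 "1 / \<epsilon>" "1 / \<epsilon>\<^sup>2" X Q
      by unfold_locales (use x0 \<epsilon> run in auto)
    have "0 < 1 / \<epsilon>\<^sup>2" using \<epsilon> by simp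
    then have "0 < real T" using T by linarith
    then have T1: "T \<ge> 1" by simp
    have D_T: "(1 / \<epsilon>\<^sup>2) * D\<^sup>2 \<le> real T * D\<^sup>2"
      using T by (intro mult_right_mono) auto
    have err: "slot_error = real k * (F + G * D)\<^sup>2 / 2 + G\<^sup>2 / 2"
      using \<epsilon> by (simp add: slot_error_def field_simps)
    have "slot_error / (1 / \<epsilon>) + 1 / \<epsilon>\<^sup>2 * D\<^sup>2 / (1 / \<epsilon> * real T)
        \<le> slot_error / (1 / \<epsilon>) + real T * D\<^sup>2 / (1 / \<epsilon> * real T)"
      using D_T \<epsilon> by (intro add_left_mono divide_right_mono) auto
    also have "\<dots> = c0 * \<epsilon>"
      using \<open>0 < real T\<close> by (simp add: err c0_def field_simps)
    also have "\<dots> \<le> c * \<epsilon>" using le_c \<epsilon> by simp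
    finally have "ereal (slot_error / (1 / \<epsilon>) + 1 / \<epsilon>\<^sup>2 * D\<^sup>2 / (1 / \<epsilon> * real T)) \<le> ereal (c * \<epsilon>)"
      by simp
    then show "ereal (time_average (expected_value M \<omega> fhat X) T)
        \<le> optimal_value M \<omega> \<X> k fhat ghat + ereal (c * \<epsilon>)"
      using objective_bound[OF T1] by (meson add_left_mono order_trans)
    fix i assume i: "i \<in> {1..k}"
    have \<mu>_T: "(1 / \<epsilon>)\<^sup>2 * (\<Sum>i=1..k. (\<mu> i)\<^sup>2) \<le> real T * (\<Sum>i=1..k. (\<mu> i)\<^sup>2)"
      using T by (intro mult_right_mono sum_nonneg) (auto simp: power_divide)
    have cancel: "(1 / \<epsilon>)\<^sup>2 * (\<Sum>i=1..k. \<mu> i)\<^sup>2 * G\<^sup>2 / (1 / \<epsilon>\<^sup>2) = (\<Sum>i=1..k. \<mu> i)\<^sup>2 * G\<^sup>2"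
      using \<epsilon> by (simp add: field_simps)
    have c1_T: "4 * real T * c1 = 4 * (real T * slot_error + real T * D\<^sup>2
        + real T * (\<Sum>i=1..k. (\<mu> i)\<^sup>2) + real T * ((\<Sum>i=1..k. \<mu> i)\<^sup>2 * G\<^sup>2))"
      unfolding c1_def c0_def err by (simp only: distrib_left mult.assoc add.assoc)
    have energy: "(\<Sum>i=1..k. mean_queue_sq i (Suc T)) + 1 / \<epsilon>\<^sup>2 * (\<Sum>t<T. mean_step_sq t)
        \<le> 4 * real T * c1"
      by (rule order_trans[OF energy_bound[OF multipliers T1]])
        (unfold cancel c1_T, intro mult_left_mono add_mono D_T \<mu>_T order_refl, simp)
    have "1 / (2 * \<epsilon>) = 1 / \<epsilon>\<^sup>2 * (\<epsilon> / 2)"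
      using \<epsilon> by (simp add: power2_eq_square)
    also have "\<dots> \<le> real T * (\<epsilon> / 2)"
      using T \<epsilon> by (intro mult_right_mono) auto
    finally have inv: "1 / (2 * \<epsilon>) \<le> real T * (\<epsilon> / 2)" .
    have step: "4 * real T * c1 / (2 * (1 / \<epsilon>\<^sup>2) * \<epsilon>) = 2 * real T * c1 * \<epsilon>"
      using \<epsilon> by (simp add: power2_eq_square)
    have "(\<Sum>t<T. expected_value M \<omega> (ghat i) X t)
        \<le> \<epsilon> / 2 * (4 * real T * c1) + real T * (\<epsilon> / 2)
          + G * (2 * real T * c1 * \<epsilon> + real T * \<epsilon> / 2)"
      using constraint_bound[OF multipliers T1 i \<epsilon> energy] inv unfolding step by linarith
    also have "\<dots> = real T * ((1 + G) * (2 * c1 + 1 / 2) * \<epsilon>)"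
      by (simp add: algebra_simps)
    also have "\<dots> \<le> real T * (c * \<epsilon>)"
      using le_c \<epsilon> by (intro mult_left_mono mult_right_mono) auto
    finally show "time_average (expected_value M \<omega> (ghat i) X) T \<le> c * \<epsilon>"
      using \<open>0 < real T\<close> by (simp add: time_average_def field_simps)
  qed
qed

end
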